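(* Let $(X,T)$ be a zero-dimensional dynamical system (i.e. $X$ is a compact metrizable zero-dimensional space and $T:X\to X$ is a homeomorphism) which is not Bratteli-Vershikizable. Then for every ordered Bratteli diagram $(B,<)$ which is a BV-model of $(X,T)$, the Vershik map $T_V$ of $(B,<)$ admits a prolongation to a homeomorphism $\widetilde T_V$ of the whole path space $X_B$ such that $(X_B,\widetilde T_V)$ is not topologically conjugate to $(X,T)$.
   Context: Bratteli diagram: a graph $B=(V,E)$ whose vertex set $V$ is a disjoint union of finite nonempty levels $V_0,V_1,V_2,\dots$ with $V_0=\{v_0\}$ a singleton, and whose edge set $E$ is a disjoint union of finite sets $E_1,E_2,\dots$. Every edge $e\in E_k$ has a source $s(e)\in V_k$ and a target $t(e)\in V_{k-1}$. Each vertex is the target of at least one edge, and each vertex of a level $k>0$ is the source of at least one edge. Multiple edges between the same pair of vertices are allowed. The path space $X_B$ is the set of all infinite sequences $(e_1,e_2,\dots)$ with $e_k\in E_k$ and $t(e_{k+1})=s(e_k)$ for all $k\ge1$ (so $t(e_1)=v_0$), with the topology inherited from $\prod_k E_k$ (each $E_k$ discrete); it is compact, metrizable and zero-dimensional. Ordered Bratteli diagram $(B,<)$: a Bratteli diagram in which, for each vertex $v\in V_k$ with $k>0$, the set of edges $e$ with $s(e)=v$ is linearly ordered; edges with different sources are incomparable. Two paths $p=(e_i)$, $p'=(e'_i)$ in $X_B$ are comparable if they are cofinal, i.e. $e_j=e'_j$ for all sufficiently large $j$; for cofinal paths, $p$ precedes $p'$ if there is $i$ with $e_j=e'_j$ for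 all $j>i$ and $e_i<e'_i$. A path is maximal (minimal) if it has no successor (no predecessor). The Vershik map $T_V$ is defined on the set of all non-maximal paths of $X_B$ and sends each such path to its immediate successor; its range is the set of all non-minimal paths, and it is a homeomorphism between its domain and range. A prolongation of $T_V$ is a map on all of $X_B$ that agrees with $T_V$ on all non-maximal paths. An ordered Bratteli diagram $(B,<)$ is a BV-model of $(X,T)$ if $T_V$ admits a continuous prolongation $\overline T_V$ to all of $X_B$ such that $(X_B,\overline T_V)$ and $(X,T)$ are topologically conjugate. An ordered Bratteli diagram $(B,<)$ is decisive if $T_V$ prolongs in a unique way to a homeomorphism $\overline T_V$ of $X_B$ (such a prolongation exists and is unique). A zero-dimensional system $(X,T)$ is Bratteli-Vershikizable if it is topologically conjugate to $(X_B,\overline T_V)$ for some decisive ordered Bratteli diagram $(B,<)$. *)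

theory Defs
  imports "HOL-Analysis.Analysis"
begin

section \<open>Zero-dimensional dynamical systems\<close>

definition zero_dimensional_space :: "'a topology \<Rightarrow> bool" where
  "zero_dimensional_space X \<longleftrightarrow> neighbourhood_base_of (\<lambda>C. openin X C \<and> closedin X C) X"

definition zero_dimensional_system :: "'a topology \<Rightarrow> ('a \<Rightarrow> 'a) \<Rightarrow> bool" where
  "zero_dimensional_system X T \<longleftrightarrow>
     compact_space X \<and> metrizable_space X \<and> zero_dimensional_space X \<and> homeomorphic_map X X T"

definition topologically_conjugate ::
    "'a topology \<Rightarrow> ('a \<Rightarrow> 'a) \<Rightarrow> 'b topology \<Rightarrow> ('b \<Rightarrow> 'b) \<Rightarrow> bool" where
  "topologically_conjugate X T Y S \<longleftrightarrow>
     (\<exists>h. homeomorphic_map X Y h \<and> (\<forall>x\<in>topspace X. h (T x) = S (h x)))"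

section \<open>Ordered Bratteli diagrams\<close>

text \<open>
  Edge levels are shifted by one: \<open>edge_level B k\<close> is the set $E_{k+1}$ of edges with source in
  $V_{k+1}$ and target in $V_k$.  Accordingly, a path $(e_1,e_2,\dots)$ is the function
  \<open>p\<close> with \<open>p k\<close> $= e_{k+1}$.
\<close>

record ('v, 'e) bratteli =
  vertex_level :: "nat \<Rightarrow> 'v set"
  edge_level :: "nat \<Rightarrow> 'e set"
  source :: "'e \<Rightarrow> 'v"
  target :: "'e \<Rightarrow> 'v"

definition bratteli_diagram :: "('v, 'e, 'z) bratteli_scheme \<Rightarrow> bool" where
  "bratteli_diagram B \<longleftrightarrow>
     (\<forall>k. finite (vertex_level B k) \<and> vertex_level B k \<noteq> {}) \<and>
     disjoint_family (vertex_level B) \<and>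
     (\<exists>v0. vertex_level B 0 = {v0}) \<and>
     (\<forall>k. finite (edge_level B k)) \<and>
     disjoint_family (edge_level B) \<and>
     (\<forall>k. \<forall>e\<in>edge_level B k. source B e \<in> vertex_level B (Suc k) \<and> target B e \<in> vertex_level B k) \<and>
     (\<forall>k. \<forall>v\<in>vertex_level B k. \<exists>e\<in>edge_level B k. target B e = v) \<and>
     (\<forall>k. \<forall>v\<in>vertex_level B (Suc k). \<exists>e\<in>edge_level B k. source B e = v)"

definition path_space :: "('v, 'e, 'z) bratteli_scheme \<Rightarrow> (nat \<Rightarrow> 'e) topology" where
  "path_space B =
     subtopology (product_topology (\<lambda>k. discrete_topology (edge_level B k)) UNIV)
       {p. \<forall>k. target B (p (Suc k)) = source B (p k)}"

text \<open>\<open>edge_order\<close> is the strict order: \<open>(e, e') \<in> edge_order B\<close> means $e < e'$.\<close>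

record ('v, 'e) ordered_bratteli = "('v, 'e) bratteli" +
  edge_order :: "('e \<times> 'e) set"

definition ordered_bratteli_diagram :: "('v, 'e, 'z) ordered_bratteli_scheme \<Rightarrow> bool" where
  "ordered_bratteli_diagram B \<longleftrightarrow>
     bratteli_diagram B \<and>
     edge_order B \<subseteq> {(e, e'). e \<in> (\<Union>k. edge_level B k) \<and> e' \<in> (\<Union>k. edge_level B k)
                              \<and> source B e = source B e'} \<and>
     (\<forall>k. \<forall>v\<in>vertex_level B (Suc k).
        strict_linear_order_on {e\<in>edge_level B k. source B e = v} (edge_order B))"

section \<open>The Vershik map and its prolongations\<close>

text \<open>Comparability (cofinality) is built in: \<open>path_less B p q\<close> forces agreement beyond \<open>i\<close>.\<close>

definition path_less :: "('v, 'e, 'z) ordered_bratteli_scheme \<Rightarrow> (nat \<Rightarrow> 'e) \<Rightarrow> (nat \<Rightarrow> 'e) \<Rightarrow> bool" where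
  "path_less B p q \<longleftrightarrow>
     p \<in> topspace (path_space B) \<and> q \<in> topspace (path_space B) \<and>
     (\<exists>i. (\<forall>j>i. p j = q j) \<and> (p i, q i) \<in> edge_order B)"

definition maximal_path :: "('v, 'e, 'z) ordered_bratteli_scheme \<Rightarrow> (nat \<Rightarrow> 'e) \<Rightarrow> bool" where
  "maximal_path B p \<longleftrightarrow> p \<in> topspace (path_space B) \<and> \<not> (\<exists>q. path_less B p q)"

definition immediate_successor ::
    "('v, 'e, 'z) ordered_bratteli_scheme \<Rightarrow> (nat \<Rightarrow> 'e) \<Rightarrow> (nat \<Rightarrow> 'e) \<Rightarrow> bool" where
  "immediate_successor B p q \<longleftrightarrow>
     path_less B p q \<and> \<not> (\<exists>r. path_less B p r \<and> path_less B r q)"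

text \<open>Meaningful only on the non-maximal paths, where the immediate successor exists and is unique.\<close>

definition vershik_map :: "('v, 'e, 'z) ordered_bratteli_scheme \<Rightarrow> (nat \<Rightarrow> 'e) \<Rightarrow> (nat \<Rightarrow> 'e)" where
  "vershik_map B p = (THE q. immediate_successor B p q)"

definition vershik_prolongation ::
    "('v, 'e, 'z) ordered_bratteli_scheme \<Rightarrow> ((nat \<Rightarrow> 'e) \<Rightarrow> (nat \<Rightarrow> 'e)) \<Rightarrow> bool" where
  "vershik_prolongation B S \<longleftrightarrow>
     S \<in> topspace (path_space B) \<rightarrow> topspace (path_space B) \<and>
     (\<forall>p\<in>topspace (path_space B). \<not> maximal_path B p \<longrightarrow> S p = vershik_map B p)"

definition homeomorphic_prolongation ::
    "('v, 'e, 'z) ordered_bratteli_scheme \<Rightarrow> ((nat \<Rightarrow> 'e) \<Rightarrow> (nat \<Rightarrow> 'e)) \<Rightarrow> bool" where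
  "homeomorphic_prolongation B S \<longleftrightarrow>
     vershik_prolongation B S \<and> homeomorphic_map (path_space B) (path_space B) S"

definition BV_model ::
    "('v, 'e, 'z) ordered_bratteli_scheme \<Rightarrow> 'a topology \<Rightarrow> ('a \<Rightarrow> 'a) \<Rightarrow> bool" where
  "BV_model B X T \<longleftrightarrow>
     ordered_bratteli_diagram B \<and>
     (\<exists>S. vershik_prolongation B S \<and> continuous_map (path_space B) (path_space B) S \<and>
          topologically_conjugate (path_space B) S X T)"

text \<open>Uniqueness is as a map on the path space; values elsewhere in the type are irrelevant.\<close>

definition decisive :: "('v, 'e, 'z) ordered_bratteli_scheme \<Rightarrow> bool" where
  "decisive B \<longleftrightarrow>
     ordered_bratteli_diagram B \<and>
     (\<exists>S. homeomorphic_prolongation B S) \<and>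
     (\<forall>S S'. homeomorphic_prolongation B S \<and> homeomorphic_prolongation B S' \<longrightarrow>
        (\<forall>p\<in>topspace (path_space B). S p = S' p))"

text \<open>
  HOL does not quantify existentially over types.  Using natural numbers as vertices and edges loses
  nothing: the vertex and edge sets are countable unions of finite sets, so every ordered Bratteli
  diagram is isomorphic to one of this form.
\<close>

definition bratteli_vershikizable :: "'a topology \<Rightarrow> ('a \<Rightarrow> 'a) \<Rightarrow> bool" where
  "bratteli_vershikizable X T \<longleftrightarrow>
     (\<exists>(B :: (nat, nat) ordered_bratteli) S.
        decisive B \<and> homeomorphic_prolongation B S \<and>
        topologically_conjugate X T (path_space B) S)"

end

theory Submission
  imports Defs
begin

text \<open>
  Let \<open>M\<close> be the closed set of maximal paths of a BV-model, transported to \<open>X\<close>.  Every periodic orbit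
  of \<open>T\<close> meets \<open>M\<close>, because the Vershik map moves non-maximal paths upwards.  Composing \<open>T\<close> with a
  homeomorphism supported in \<open>M\<close> gives another homeomorphic prolongation; suppose that all of these are
  conjugate to \<open>T\<close>.  Then

  \<^item> all isolated periodic points lie in one orbit: otherwise, with \<open>k\<close> the least period of an isolated
    point, orbits through \<open>M\<close> can be joined so as to diminish the set of isolated \<open>k\<close>-periodic points;
  \<^item> no nonempty open set consists of periodic non-isolated points: otherwise \<open>M\<close> contains a clopen Cantor
    set \<open>C\<close> returning identically after constant time, and the first return to \<open>C\<close> can be replaced by
    homeomorphisms with uncountably many different sets of periods, while \<open>X\<close> has only countably many
    clopen subsets that could be the image of \<open>C\<close> under a conjugacy.

  These two properties suffice for a decisive model.  Starting from \<open>X\<close>, remove from a marker set, one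
  after another, small clopen sets around points that return to it at a different point; the
  intersection \<open>Y\<close> of the markers then has at most one interior point.  In the Bratteli diagram of the
  associated towers the set of maximal paths is \<open>T\<^sup>-\<^sup>1 Y\<close>, so there is only one way to prolong the Vershik map
  to a homeomorphism.
\<close>

section \<open>Ordered Bratteli diagrams\<close>

text \<open>Two homeomorphic prolongations can differ only on an open set of maximal paths, so the
  aim is a marker intersection with hardly any interior. A single interior point does no harm:
  bijections of the same space that agree elsewhere agree there too. What the removals cannot
  destroy are clopen sets whose points return only at themselves, and these consist of periodic
  points; hence the two properties, one for isolated and one for non-isolated periodic points. In
  the first, a permutation of infinitely many isolated points is continuous only if it nearly
  preserves each clopen set, so a special derangement is built; a finite family is treated by
  counting. In the second, growing alphabets let the cycles of length \<open>n + 3\<close> be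
  switched on or off independently for each \<open>n\<close>, and the summand 3 keeps them apart
  from fixed points. In the diagram, the order of paths has to match the height in a column; for
  this, each word must determine its decomposition into words of the level below.\<close>

lemma topspace_path_space:
  "topspace (path_space B) =
     {p. (\<forall>k. p k \<in> edge_level B k) \<and> (\<forall>k. target B (p (Suc k)) = source B (p k))}"
  by (auto simp: path_space_def PiE_iff)

context
  fixes B :: "('v, 'e, 'z) ordered_bratteli_scheme"
  assumes ord: "ordered_bratteli_diagram B"
begin

text \<open>\<open>strict_linear_order_on\<close> imposes transitivity and irreflexivity on the
  whole relation, not only on the edges at one vertex, so a single vertex of level 1 yields
  both.\<close>

lemma edge_order_trans: "trans (edge_order B)"
  and edge_order_irrefl: "irrefl (edge_order B)"
proof -
  have "vertex_level B (Suc 0) \<noteq> {}"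
    using ord unfolding ordered_bratteli_diagram_def bratteli_diagram_def by blast
  then show "trans (edge_order B)" "irrefl (edge_order B)"
    using ord unfolding ordered_bratteli_diagram_def strict_linear_order_on_def by blast+
qed

lemma edge_order_source: "(e, e') \<in> edge_order B \<Longrightarrow> source B e = source B e'"
  using ord unfolding ordered_bratteli_diagram_def by blast

lemma edge_order_total:
  assumes "e \<in> edge_level B k" "e' \<in> edge_level B k" "source B e = source B e'" "e \<noteq> e'"
  shows "(e, e') \<in> edge_order B \<or> (e', e) \<in> edge_order B"
proof -
  have "source B e \<in> vertex_level B (Suc k)"
    using ord assms(1) unfolding ordered_bratteli_diagram_def bratteli_diagram_def by blast
  then have "total_on {d \<in> edge_level B k. source B d = source B e} (edge_order B)"
    using ord unfolding ordered_bratteli_diagram_def strict_linear_order_on_def by blast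
  then show ?thesis
    using assms unfolding total_on_def by auto
qed

lemma path_less_trans:
  assumes "path_less B p q" "path_less B q r"
  shows "path_less B p r"
proof -
  obtain a where a: "\<forall>j>a. p j = q j" "(p a, q a) \<in> edge_order B"
    using assms(1) unfolding path_less_def by blast
  obtain b where b: "\<forall>j>b. q j = r j" "(q b, r b) \<in> edge_order B"
    using assms(2) unfolding path_less_def by blast
  have "(p (max a b), r (max a b)) \<in> edge_order B"
  proof (cases a b rule: linorder_cases)
    case equal
    then show ?thesis
      using transD[OF edge_order_trans a(2)] b(2) by simp
  qed (use a b in \<open>auto simp: max_def\<close>)
  moreover have "\<forall>j>max a b. p j = r j"
    using a b by auto
  ultimately show ?thesis
    using assms unfolding path_less_def by blast
qed

lemma path_less_irrefl: "\<not> path_less B p p"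
  using edge_order_irrefl unfolding path_less_def irrefl_def by blast

lemma path_less_linear:
  assumes p: "p \<in> topspace (path_space B)" and q: "q \<in> topspace (path_space B)"
    and cofinal: "\<forall>j>i. p j = q j" and "p \<noteq> q"
  shows "path_less B p q \<or> path_less B q p"
proof -
  have fin: "finite {j. p j \<noteq> q j}"
    using cofinal by (rule_tac finite_subset[of _ "{..i}"]) (auto intro: leI)
  have ne: "{j. p j \<noteq> q j} \<noteq> {}"
    using \<open>p \<noteq> q\<close> by auto
  define m where "m = Max {j. p j \<noteq> q j}"
  have m: "p m \<noteq> q m" and above: "\<forall>j>m. p j = q j"
    using Max_in[OF fin ne] Max_ge[OF fin] unfolding m_def by (auto dest: leD)
  \<comment> \<open>Above \<open>m\<close> the paths agree, and both edges have the target of the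
    common next edge as source.\<close>
  have "source B (p m) = source B (q m)"
    using p q above[rule_format, of "Suc m"] by (simp add: topspace_path_space) metis
  then have "(p m, q m) \<in> edge_order B \<or> (q m, p m) \<in> edge_order B"
    using p q m by (intro edge_order_total[of _ m]) (auto simp: topspace_path_space)
  then show ?thesis
    using p q above unfolding path_less_def by metis
qed

lemma path_less_cofinal_linear:
  assumes "path_less B p q" "path_less B p r" "q \<noteq> r"
  shows "path_less B q r \<or> path_less B r q"
proof -
  obtain a where a: "\<forall>j>a. p j = q j"
    using assms(1) unfolding path_less_def by blast
  obtain b where b: "\<forall>j>b. p j = r j"
    using assms(2) unfolding path_less_def by blast
  have "\<forall>j>max a b. q j = r j"
    using a b by (metis max_less_iff_conj)
  then show ?thesis
    using path_less_linear[of q r] assms unfolding path_less_def by blast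
qed

lemma immediate_successor_unique:
  assumes "immediate_successor B p q" "immediate_successor B p r"
  shows "q = r"
  using assms path_less_cofinal_linear[of p q r] unfolding immediate_successor_def by blast

text \<open>The later of the two deciding indices is a place where \<open>p\<close> and
  \<open>q\<close> themselves differ, hence at most \<open>i\<close>.\<close>

lemma path_less_between:
  assumes "path_less B p r" "path_less B r q" "\<forall>j>i. p j = q j"
  shows "\<forall>j>i. r j = q j"
proof -
  obtain a where a: "\<forall>j>a. p j = r j" "(p a, r a) \<in> edge_order B"
    using assms(1) unfolding path_less_def by blast
  obtain b where b: "\<forall>j>b. r j = q j" "(r b, q b) \<in> edge_order B"
    using assms(2) unfolding path_less_def by blast
  have "(p (max a b), q (max a b)) \<in> edge_order B"
  proof (cases a b rule: linorder_cases)
    case equal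
    then show ?thesis
      using transD[OF edge_order_trans a(2)] b(2) by simp
  qed (use a b in \<open>auto simp: max_def\<close>)
  then have "p (max a b) \<noteq> q (max a b)"
    using edge_order_irrefl unfolding irrefl_def by metis
  then have "max a b \<le> i"
    using assms(3) by (meson not_le)
  then show ?thesis
    using b by auto
qed

text \<open>Only finitely many paths share the tail of \<open>p\<close> beyond \<open>i\<close>. A
  minimal one among those above \<open>p\<close> is the immediate successor, since
  \<open>path_less_between\<close> keeps every intermediate path in this finite set.\<close>

lemma immediate_successor_exists:
  assumes p: "p \<in> topspace (path_space B)" and "\<not> maximal_path B p"
  shows "\<exists>q. immediate_successor B p q"
proof -
  obtain q0 where q0: "path_less B p q0"
    using assms unfolding maximal_path_def by blast
  then obtain i where i: "\<forall>j>i. p j = q0 j"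
    unfolding path_less_def by blast
  define Q where "Q = {q. path_less B p q \<and> (\<forall>j>i. q j = p j)}"
  have "Q \<subseteq> (\<lambda>f j. if j \<le> i then f j else p j) ` PiE {..i} (edge_level B)"
  proof
    fix q assume q: "q \<in> Q"
    then have "q \<in> topspace (path_space B)" "\<forall>j>i. q j = p j"
      unfolding Q_def path_less_def by auto
    then have "q = (\<lambda>j. if j \<le> i then (restrict q {..i}) j else p j)"
      and "restrict q {..i} \<in> PiE {..i} (edge_level B)"
      by (auto simp: topspace_path_space not_le)
    then show "q \<in> (\<lambda>f j. if j \<le> i then f j else p j) ` PiE {..i} (edge_level B)"
      by blast
  qed
  moreover have "finite (PiE {..i} (edge_level B))"
    using ord unfolding ordered_bratteli_diagram_def bratteli_diagram_def
    by (intro finite_PiE) auto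
  ultimately have "finite Q"
    using finite_surj by blast
  moreover have "Q \<noteq> {}"
    using q0 i unfolding Q_def by auto
  moreover have "asymp_on Q (path_less B)" "transp_on Q (path_less B)"
    using path_less_irrefl path_less_trans by (auto intro!: asymp_onI transp_onI)
  ultimately obtain q where q: "q \<in> Q" "\<And>r. r \<in> Q \<Longrightarrow> \<not> path_less B r q"
    using Finite_Set.bex_min_element[of Q "path_less B"] path_less_irrefl by metis
  have "\<not> (path_less B p r \<and> path_less B r q)" for r
  proof
    assume r: "path_less B p r \<and> path_less B r q"
    have "\<forall>j>i. p j = q j"
      using q(1) unfolding Q_def by auto
    then have "r \<in> Q"
      using path_less_between[of p r q i] r unfolding Q_def by simp
    then show False
      using q(2) r by blast
  qed
  then show ?thesis
    using q(1) unfolding immediate_successor_def Q_def by blast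
qed

lemma vershik_map_eqI: "immediate_successor B p q \<Longrightarrow> vershik_map B p = q"
  unfolding vershik_map_def using immediate_successor_unique by blast

lemma path_less_vershik_map:
  assumes "p \<in> topspace (path_space B)" "\<not> maximal_path B p"
  shows "path_less B p (vershik_map B p)"
  using immediate_successor_exists[OF assms] vershik_map_eqI
  unfolding immediate_successor_def by metis

lemma openin_cylinder: "openin (path_space B) {r \<in> topspace (path_space B). r k = a}"
proof -
  have "continuous_map (path_space B) (discrete_topology (edge_level B k)) (\<lambda>r. r k)"
    unfolding path_space_def
    by (intro continuous_map_from_subtopology continuous_map_product_projection) auto
  then have "openin (path_space B) {r \<in> topspace (path_space B). r k \<in> {a} \<inter> edge_level B k}"
    by (rule openin_continuous_map_preimage) auto
  moreover have "{r \<in> topspace (path_space B). r k \<in> {a} \<inter> edge_level B k}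
      = {r \<in> topspace (path_space B). r k = a}"
    by (auto simp: topspace_path_space)
  ultimately show ?thesis
    by simp
qed

text \<open>Non-maximality is witnessed by one coordinate: if \<open>q\<close> is above
  \<open>p\<close> with deciding index \<open>i\<close>, the beginning of \<open>q\<close> up to
  \<open>i\<close> can be grafted onto any path through the edge \<open>p i\<close>, because
  \<open>q i\<close> has the same source.\<close>

lemma closedin_maximal_paths: "closedin (path_space B) {p. maximal_path B p}"
proof -
  let ?P = "topspace (path_space B)"
  have "openin (path_space B) (?P - {p. maximal_path B p})"
  proof (subst openin_subopen, intro ballI)
    fix p assume p: "p \<in> ?P - {p. maximal_path B p}"
    then obtain q where "path_less B p q"
      unfolding maximal_path_def by blast
    then obtain i where q: "q \<in> ?P" and i: "\<forall>j>i. p j = q j" "(p i, q i) \<in> edge_order B"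
      unfolding path_less_def by blast
    define N where "N = {r \<in> ?P. r i = p i}"
    have "path_less B r (\<lambda>j. if j \<le> i then q j else r j)" if r: "r \<in> N" for r
    proof -
      have "source B (q i) = source B (r i)"
        using edge_order_source[OF i(2)] r unfolding N_def by simp
      then have "target B (if Suc k \<le> i then q (Suc k) else r (Suc k))
          = source B (if k \<le> i then q k else r k)" for k
        using q r unfolding N_def topspace_path_space
        by (cases k i rule: linorder_cases) auto
      then have "(\<lambda>j. if j \<le> i then q j else r j) \<in> ?P"
        using q r unfolding N_def topspace_path_space by auto
      then show ?thesis
        using i(2) r unfolding path_less_def N_def by (intro conjI exI[of _ i]) auto
    qed
    then have "N \<subseteq> ?P - {p. maximal_path B p}"
      unfolding maximal_path_def N_def by blast
    then show "\<exists>N. openin (path_space B) N \<and> p \<in> N \<and> N \<subseteq> ?P - {p. maximal_path B p}"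
      using p openin_cylinder[of i "p i"] unfolding N_def by (intro exI[of _ N]) (auto simp: N_def)
  qed
  moreover have "{p. maximal_path B p} \<subseteq> ?P"
    unfolding maximal_path_def by blast
  ultimately show ?thesis
    by (simp add: closedin_def)
qed

lemma periodic_hits_maximal:
  assumes S: "vershik_prolongation B S" and p: "p \<in> topspace (path_space B)"
    and "k > 0" "(S ^^ k) p = p"
  shows "\<exists>i. maximal_path B ((S ^^ i) p)"
proof (rule ccontr)
  assume no: "\<not> ?thesis"
  have in_space: "(S ^^ i) p \<in> topspace (path_space B)" for i
    using S p unfolding vershik_prolongation_def by (induction i) auto
  have step: "path_less B ((S ^^ i) p) ((S ^^ Suc i) p)" for i
    using S no in_space[of i] path_less_vershik_map[OF in_space[of i]]
    unfolding vershik_prolongation_def by simp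
  have "path_less B p ((S ^^ Suc i) p)" for i
  proof (induction i)
    case 0
    then show ?case
      using step[of 0] by simp
  next
    case (Suc i)
    then show ?case
      using step[of "Suc i"] path_less_trans by blast
  qed
  then show False
    using assms path_less_irrefl by (metis gr0_conv_Suc)
qed

end

section \<open>Compact metrizable zero-dimensional spaces\<close>

definition clopenin :: "'a topology \<Rightarrow> 'a set \<Rightarrow> bool" where
  "clopenin X C \<longleftrightarrow> openin X C \<and> closedin X C"

lemma clopenin_openin: "clopenin X C \<Longrightarrow> openin X C"
  and clopenin_closedin: "clopenin X C \<Longrightarrow> closedin X C"
  and clopenin_subset: "clopenin X C \<Longrightarrow> C \<subseteq> topspace X"
  by (auto simp: clopenin_def openin_subset)

lemma clopenin_empty [simp]: "clopenin X {}"
  and clopenin_topspace [simp]: "clopenin X (topspace X)"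
  by (auto simp: clopenin_def)

lemma clopenin_Int: "clopenin X C \<Longrightarrow> clopenin X D \<Longrightarrow> clopenin X (C \<inter> D)"
  and clopenin_Un: "clopenin X C \<Longrightarrow> clopenin X D \<Longrightarrow> clopenin X (C \<union> D)"
  and clopenin_Diff: "clopenin X C \<Longrightarrow> clopenin X D \<Longrightarrow> clopenin X (C - D)"
  by (auto simp: clopenin_def)

lemma clopenin_vimage:
  assumes "continuous_map X Y f" "clopenin Y C"
  shows "clopenin X {x \<in> topspace X. f x \<in> C}"
  using assms openin_continuous_map_preimage closedin_continuous_map_preimage
  unfolding clopenin_def by blast

lemma clopenin_image:
  assumes "homeomorphic_map X Y f" "clopenin X C"
  shows "clopenin Y (f ` C)"
  using assms homeomorphic_map_openness homeomorphic_map_closedness clopenin_subset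
  unfolding clopenin_def by metis

text \<open>Balls of radius \<open>1 / Suc n\<close> around finite nets form a countable base; by
  compactness a clopen set is a finite union of its members.\<close>

lemma countable_clopenin:
  assumes comp: "compact_space X" and met: "metrizable_space X"
  shows "countable {C. clopenin X C}"
proof -
  obtain M d where md: "Metric_space M d" and X: "X = Metric_space.mtopology M d"
    using met unfolding metrizable_space_def by blast
  interpret Metric_space M d
    by (rule md)
  have "mtotally_bounded M"
    using comp compact_space_eq_mcomplete_mtotally_bounded unfolding X by blast
  then have "\<exists>K. finite K \<and> K \<subseteq> M \<and> M \<subseteq> (\<Union>x\<in>K. mball x (1 / Suc n))" for n
    unfolding mtotally_bounded_def by simp
  then obtain K where K: "\<And>n. finite (K n)" "\<And>n. K n \<subseteq> M"
      "\<And>n. M \<subseteq> (\<Union>x\<in>K n. mball x (1 / Suc n))"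
    by metis
  define \<B> where "\<B> = (\<Union>n. (\<lambda>x. mball x (1 / Suc n)) ` K n)"
  have "countable \<B>"
    unfolding \<B>_def using K(1) by (intro countable_UN countable_image) (auto intro: countable_finite)
  then have fins: "countable {F. F \<subseteq> \<B> \<and> finite F}"
    using countable_Collect_finite_subset by (simp add: conj_commute)
  have "{C. clopenin X C} \<subseteq> Union ` {F. F \<subseteq> \<B> \<and> finite F}"
  proof
    fix C assume "C \<in> {C. clopenin X C}"
    then have C: "openin X C" "closedin X C"
      unfolding clopenin_def by auto
    have "\<exists>W\<in>\<B>. x \<in> W \<and> W \<subseteq> C" if x: "x \<in> C" for x
    proof -
      obtain r where r: "r > 0" "mball x r \<subseteq> C"
        using C(1) x unfolding X openin_mtopology by blast
      obtain n where n: "1 / Suc n < r / 2"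
        using r(1) by (metis half_gt_zero nat_approx_posE)
      have xM: "x \<in> M"
        using x closedin_subset[OF C(2)] unfolding X by auto
      then obtain y where y: "y \<in> K n" "x \<in> mball y (1 / Suc n)"
        using K(3)[of n] by blast
      have "mball y (1 / Suc n) \<subseteq> mball x r"
      proof
        fix z assume z: "z \<in> mball y (1 / Suc n)"
        then have "d x z \<le> d x y + d y z"
          using y xM by (intro triangle) auto
        also have "\<dots> < r"
          using y z n by (simp add: commute)
        finally show "z \<in> mball x r"
          using z xM by simp
      qed
      then show ?thesis
        using y r unfolding \<B>_def by blast
    qed
    then have "C \<subseteq> \<Union>{W \<in> \<B>. W \<subseteq> C}"
      by blast
    moreover have "compactin X C"
      using C(2) comp closedin_compact_space by blast
    moreover have "openin X W" if "W \<in> {W \<in> \<B>. W \<subseteq> C}" for W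
      using that unfolding \<B>_def X by auto
    ultimately obtain F where F: "finite F" "F \<subseteq> {W \<in> \<B>. W \<subseteq> C}" "C \<subseteq> \<Union>F"
      unfolding compactin_def by meson
    then have "C = \<Union>F"
      by blast
    then show "C \<in> Union ` {F. F \<subseteq> \<B> \<and> finite F}"
      using F by blast
  qed
  then show ?thesis
    by (rule countable_subset) (rule countable_image[OF fins])
qed

locale zspace =
  fixes X :: "'a topology"
  assumes compact: "compact_space X"
    and metrizable: "metrizable_space X"
    and zero_dim: "zero_dimensional_space X"
begin

lemma Hausdorff: "Hausdorff_space X"
  using metrizable metrizable_imp_Hausdorff_space by blast

lemma clopen_nbhd:
  assumes "openin X V" "x \<in> V"
  obtains C where "clopenin X C" "x \<in> C" "C \<subseteq> V"
proof -
  obtain U C where "openin X U" "openin X C \<and> closedin X C" "x \<in> U" "U \<subseteq> C" "C \<subseteq> V"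
    using zero_dim assms unfolding zero_dimensional_space_def neighbourhood_base_of by metis
  then show ?thesis
    using that[of C] unfolding clopenin_def by blast
qed

lemma clopen_separation:
  assumes "x \<in> topspace X" "y \<in> topspace X" "x \<noteq> y"
  obtains C where "clopenin X C" "x \<in> C" "y \<notin> C"
proof -
  obtain U V where "openin X U" "openin X V" "x \<in> U" "y \<in> V" "disjnt U V"
    using Hausdorff assms unfolding Hausdorff_space_def by metis
  then obtain C where "clopenin X C" "x \<in> C" "C \<subseteq> U"
    using clopen_nbhd by blast
  then show ?thesis
    using that \<open>y \<in> V\<close> \<open>disjnt U V\<close> by (auto simp: disjnt_iff)
qed

lemma openin_iff_clopen_nbhd:
  "openin X V \<longleftrightarrow> (\<forall>x\<in>V. \<exists>C. clopenin X C \<and> x \<in> C \<and> C \<subseteq> V)"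
proof
  assume "openin X V"
  then show "\<forall>x\<in>V. \<exists>C. clopenin X C \<and> x \<in> C \<and> C \<subseteq> V"
    using clopen_nbhd by metis
next
  assume "\<forall>x\<in>V. \<exists>C. clopenin X C \<and> x \<in> C \<and> C \<subseteq> V"
  then show "openin X V"
    using openin_subopen[of X V] clopenin_openin by metis
qed

lemma continuous_map_clopenI:
  assumes "f \<in> topspace Y \<rightarrow> topspace X"
    and "\<And>C. clopenin X C \<Longrightarrow> openin Y {x \<in> topspace Y. f x \<in> C}"
  shows "continuous_map Y X f"
  unfolding continuous_map
proof (intro conjI allI impI)
  show "f ` topspace Y \<subseteq> topspace X"
    using assms(1) by auto
  fix U assume "openin X U"
  then have "{x \<in> topspace Y. f x \<in> U} = \<Union>{{x \<in> topspace Y. f x \<in> C} |C. clopenin X C \<and> C \<subseteq> U}"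
    using openin_iff_clopen_nbhd[of U] by blast
  also have "openin Y \<dots>"
    using assms(2) by (intro openin_Union) auto
  finally show "openin Y {x \<in> topspace Y. f x \<in> U}" .
qed

text \<open>An enumeration, possibly with repetitions. It serves twice: to separate points, and as
  the list of sets that the marker construction has to treat.\<close>

definition clopens :: "nat \<Rightarrow> 'a set" where
  "clopens = from_nat_into {C. clopenin X C}"

lemma range_clopens: "range clopens = {C. clopenin X C}"
  unfolding clopens_def
  using countable_clopenin[OF compact metrizable] clopenin_empty[of X]
  by (intro range_from_nat_into) blast+

lemma clopenin_clopens: "clopenin X (clopens n)"
  using range_clopens by blast

lemma clopensE:
  assumes "clopenin X C"
  obtains n where "C = clopens n"
  using range_clopens assms by blast

lemma eq_if_same_clopens:
  assumes "x \<in> topspace X" "y \<in> topspace X" "\<And>n. x \<in> clopens n \<longleftrightarrow> y \<in> clopens n"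
  shows "x = y"
  using assms clopen_separation clopensE by metis

lemma clopen_nest:
  fixes C :: "nat \<Rightarrow> 'a set"
  assumes "\<And>n. clopenin X (C n)" "\<And>n. C n \<noteq> {}" "\<And>n. C (Suc n) \<subseteq> C n"
  shows "(\<Inter>n. C n) \<noteq> {}"
proof (rule compact_space_imp_nest[OF compact])
  show "decseq C"
    using assms(3) by (rule decseq_SucI)
qed (use assms in \<open>auto intro: clopenin_closedin\<close>)

text \<open>Baire category inside an open set: if no \<open>F n\<close> had interior in
  \<open>V\<close>, one could choose nested nonempty clopen sets avoiding \<open>F 0\<close>,
  \<open>F 1\<close>, ... in turn, and their common point would lie in no
  \<open>F n\<close>.\<close>

lemma Baire_open:
  assumes V: "openin X V" "V \<noteq> {}" and cover: "V \<subseteq> (\<Union>n::nat. F n)" and F: "\<And>n. closedin X (F n)"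
  shows "\<exists>n W. openin X W \<and> W \<noteq> {} \<and> W \<subseteq> V \<and> W \<subseteq> F n"
proof (rule ccontr)
  assume no: "\<not> ?thesis"
  have step: "\<exists>D. clopenin X D \<and> D \<noteq> {} \<and> D \<subseteq> C \<and> D \<inter> F n = {}"
    if C: "openin X C" "C \<noteq> {}" "C \<subseteq> V" for C n
  proof -
    have "\<not> C \<subseteq> F n"
      using no C by blast
    then obtain x where x: "x \<in> C - F n"
      by blast
    have "openin X (C - F n)"
      using C(1) F by (rule openin_diff)
    then obtain D where "clopenin X D" "x \<in> D" "D \<subseteq> C - F n"
      using x by (rule clopen_nbhd)
    then show ?thesis
      by blast
  qed
  obtain D0 where D0: "clopenin X D0 \<and> D0 \<noteq> {} \<and> D0 \<subseteq> V"
    using V clopen_nbhd by (metis all_not_in_conv)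
  have "\<exists>D. \<forall>n. (clopenin X (D n) \<and> D n \<noteq> {} \<and> D n \<subseteq> V) \<and> (D (Suc n) \<subseteq> D n \<and> D (Suc n) \<inter> F n = {})"
  proof (rule dependent_nat_choice)
    show "\<exists>D. clopenin X D \<and> D \<noteq> {} \<and> D \<subseteq> V"
      using D0 by blast
    fix C n assume "clopenin X C \<and> C \<noteq> {} \<and> C \<subseteq> V"
    then show "\<exists>D. (clopenin X D \<and> D \<noteq> {} \<and> D \<subseteq> V) \<and> D \<subseteq> C \<and> D \<inter> F n = {}"
      using step[of C n] clopenin_openin by (meson subset_trans)
  qed
  then obtain D where D: "\<And>n. clopenin X (D n)" "\<And>n. D n \<noteq> {}" "\<And>n. D n \<subseteq> V"
      "\<And>n. D (Suc n) \<subseteq> D n" "\<And>n. D (Suc n) \<inter> F n = {}"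
    by blast
  then have "(\<Inter>n. D n) \<noteq> {}"
    by (intro clopen_nest)
  then obtain x where x: "\<And>n. x \<in> D n"
    by blast
  then obtain n where "x \<in> F n"
    using D(3)[of 0] cover by blast
  then show False
    using x[of "Suc n"] D(5)[of n] by blast
qed

end

section \<open>Isolated periodic points\<close>

text \<open>There are at most \<open>2 ^ m\<close> membership patterns, so the finite classes among
  them have a finite union.\<close>

lemma finite_signature_classes:
  fixes D :: "nat \<Rightarrow> 'a set"
  shows "finite {a. finite {c. \<forall>i<m. c \<in> D i \<longleftrightarrow> a \<in> D i}}"
proof -
  define K where "K S = {c. \<forall>i<m. c \<in> D i \<longleftrightarrow> i \<in> S}" for S
  have "{a. finite {c. \<forall>i<m. c \<in> D i \<longleftrightarrow> a \<in> D i}} \<subseteq> \<Union>{K S |S. S \<in> Pow {..<m} \<and> finite (K S)}"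
  proof
    fix a assume a: "a \<in> {a. finite {c. \<forall>i<m. c \<in> D i \<longleftrightarrow> a \<in> D i}}"
    define S where "S = {i. i < m \<and> a \<in> D i}"
    have "K S = {c. \<forall>i<m. c \<in> D i \<longleftrightarrow> a \<in> D i}"
      unfolding K_def S_def by blast
    then show "a \<in> \<Union>{K S |S. S \<in> Pow {..<m} \<and> finite (K S)}"
      using a by (auto intro!: exI[of _ "K S"] exI[of _ S] simp: S_def)
  qed
  moreover have "finite (\<Union>{K S |S. S \<in> Pow {..<m} \<and> finite (K S)})"
    by (intro finite_Union) auto
  ultimately show ?thesis
    using finite_subset by blast
qed

text \<open>Greedy pairing: the \<open>n\<close>-th pair agrees on as many of the sets \<open>D 0, \<dots>, D (n - 1)\<close> as
  infinitely many candidates do.\<close>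

lemma derangement_respecting_sets:
  fixes D :: "nat \<Rightarrow> nat set"
  shows "\<exists>f :: nat \<Rightarrow> nat. bij f \<and> (\<forall>x. f x \<noteq> x) \<and> (\<forall>j. finite {x. (x \<in> D j) \<noteq> (f x \<in> D j)})"
proof -
  define cls where "cls m a = {c. \<forall>i<m. c \<in> D i \<longleftrightarrow> a \<in> D i}" for m a
  have step: "\<exists>a b. a \<notin> F \<and> b \<notin> F \<and> a \<noteq> b \<and> (n \<in> F \<or> n = a) \<and>
      (\<forall>m\<le>n. infinite (cls m a) \<longrightarrow> b \<in> cls m a)" if F: "finite F" for F :: "nat set" and n :: nat
  proof -
    \<comment> \<open>Taking \<open>n\<close> itself whenever it is still free ensures that every
      number is eventually paired.\<close>
    obtain a where a: "a \<notin> F" "n \<in> F \<or> n = a"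
      using ex_new_if_finite[OF infinite_UNIV_nat F] by metis
    \<comment> \<open>Depth 0 always qualifies, since \<open>cls 0 a\<close> is everything. The
      partner comes from the deepest infinite class, which is contained in all shallower
      ones.\<close>
    define I where "I = {m. m \<le> n \<and> infinite (cls m a)}"
    have "finite I" and "0 \<in> I"
      unfolding I_def cls_def by auto
    then have max: "Max I \<in> I" "\<And>m. m \<in> I \<Longrightarrow> m \<le> Max I"
      using Max_in by auto
    then have "infinite (cls (Max I) a)"
      unfolding I_def by blast
    then have "infinite (cls (Max I) a - (insert a F))"
      using F by simp
    then obtain b where b: "b \<in> cls (Max I) a" "b \<notin> F" "b \<noteq> a"
      by (metis DiffE finite.emptyI insertCI all_not_in_conv)
    have "b \<in> cls m a" if "m \<le> n" "infinite (cls m a)" for m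
    proof -
      have "m \<le> Max I"
        using max(2)[of m] that unfolding I_def by blast
      then show ?thesis
        using b(1) unfolding cls_def by auto
    qed
    then show ?thesis
      using a b by blast
  qed
  then obtain A B where AB: "\<And>F n. finite F \<Longrightarrow> A F n \<notin> F \<and> B F n \<notin> F \<and> A F n \<noteq> B F n \<and>
      (n \<in> F \<or> n = A F n) \<and> (\<forall>m\<le>n. infinite (cls m (A F n)) \<longrightarrow> B F n \<in> cls m (A F n))"
    by metis
  define F where "F = rec_nat {} (\<lambda>n F. F \<union> {A F n, B F n})"
  have F0: "F 0 = {}" and FS: "F (Suc n) = F n \<union> {A (F n) n, B (F n) n}" for n
    unfolding F_def by auto
  have fin: "finite (F n)" for n
    by (induction n) (auto simp: F0 FS)
  define a where "a n = A (F n) n" for n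
  define b where "b n = B (F n) n" for n
  have ab: "a n \<notin> F n" "b n \<notin> F n" "a n \<noteq> b n" "n \<in> F n \<or> n = a n"
      "\<And>m. m \<le> n \<Longrightarrow> infinite (cls m (a n)) \<Longrightarrow> b n \<in> cls m (a n)" for n
    using AB[OF fin[of n], of n] unfolding a_def b_def by auto
  have FS': "F (Suc n) = F n \<union> {a n, b n}" for n
    using FS unfolding a_def b_def .
  have F_eq: "F n = {a i |i. i < n} \<union> {b i |i. i < n}" for n
    by (induction n) (auto simp: F0 FS' less_Suc_eq)
  have dist: "a n \<noteq> a m" "b n \<noteq> b m" "a n \<noteq> b m" "b n \<noteq> a m" if "n < m" for n m
    using ab(1,2)[of m] that unfolding F_eq by auto
  have inj: "a n = a m \<longleftrightarrow> n = m" "b n = b m \<longleftrightarrow> n = m" "a n \<noteq> b m" for n m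
    using dist ab(3) by (metis linorder_neqE_nat)+
  have all: "\<exists>n. x = a n \<or> x = b n" for x
    using ab(4)[of x] unfolding F_eq by blast
  define f where "f x = (if \<exists>n. x = a n then b (THE n. x = a n) else a (THE n. x = b n))" for x
  have fa: "f (a n) = b n" and fb: "f (b n) = a n" for n
    unfolding f_def using inj(3) inj(3)[THEN not_sym] by (auto simp: inj)
  have ff: "f (f x) = x" for x
    using all[of x] fa fb by auto
  then have "bij f"
    by (intro o_bij[of f]) auto
  moreover have "f x \<noteq> x" for x
    using all[of x] fa fb inj(3) by metis
  moreover have "finite {x. (x \<in> D j) \<noteq> (f x \<in> D j)}" for j
  proof -
    define G where "G = {a. finite (cls (Suc j) a)}"
    have "finite G"
      unfolding G_def cls_def by (rule finite_signature_classes)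
    \<comment> \<open>A pair split by \<open>D j\<close> is among the first \<open>j + 1\<close>
      pairs or starts in a finite class of depth \<open>j + 1\<close>; either way only finitely many
      occur.\<close>
    have pair: "a n \<in> F (Suc j) \<union> G" if "(a n \<in> D j) \<noteq> (b n \<in> D j)" for n
    proof (cases "n \<le> j")
      case True
      then show ?thesis
        unfolding F_eq by auto
    next
      case False
      then have "b n \<notin> cls (Suc j) (a n)"
        using that unfolding cls_def by auto
      then have "a n \<in> G"
        using False ab(5)[of "Suc j" n] unfolding G_def by auto
      then show ?thesis ..
    qed
    have "x \<in> F (Suc j) \<union> G \<union> f ` (F (Suc j) \<union> G)" if x: "(x \<in> D j) \<noteq> (f x \<in> D j)" for x
    proof -
      obtain n where "x = a n \<or> x = b n"
        using all by blast
      then show ?thesis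
      proof
        assume "x = a n"
        then show ?thesis
          using pair[of n] x fa by auto
      next
        assume xb: "x = b n"
        then have "a n \<in> F (Suc j) \<union> G"
          using pair[of n] x fb by auto
        then have "f (a n) \<in> f ` (F (Suc j) \<union> G)"
          by (rule imageI)
        then show ?thesis
          using fa xb by simp
      qed
    qed
    then have "{x. (x \<in> D j) \<noteq> (f x \<in> D j)} \<subseteq> F (Suc j) \<union> G \<union> f ` (F (Suc j) \<union> G)"
      by blast
    then show ?thesis
      using fin \<open>finite G\<close> by (meson finite_UnI finite_imageI finite_subset)
  qed
  ultimately show ?thesis
    by blast
qed

lemma funpow_swap: "(f ^^ i) ((f ^^ j) x) = (f ^^ j) ((f ^^ i) x)"
  by (metis add.commute funpow_add o_apply)

lemma homeomorphic_map_funpow: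
  "homeomorphic_map X X f \<Longrightarrow> homeomorphic_map X X (f ^^ i)"
proof (induction i)
  case 0
  then show ?case
    using homeomorphic_map_id by (metis funpow_0 eq_id_iff)
next
  case (Suc i)
  then show ?case
    using homeomorphic_map_compose[of X X "f ^^ i" X f] by (simp del: o_apply)
qed

lemma conjugacy_funpow:
  assumes h: "\<And>x. x \<in> topspace X \<Longrightarrow> h (T x) = S (h x)" and T: "T \<in> topspace X \<rightarrow> topspace X"
    and "x \<in> topspace X"
  shows "h ((T ^^ i) x) = (S ^^ i) (h x)"
proof -
  have "(T ^^ i) x \<in> topspace X" for i
    using assms by (induction i) auto
  then show ?thesis
    using h by (induction i) auto
qed

context zspace
begin

text \<open>The preimage of a clopen set \<open>C\<close> differs from \<open>C\<close> only within
  \<open>R\<close>: it loses a finite, hence closed, set of points and gains points that are open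
  singletons.\<close>

lemma homeomorphic_map_permute_isolated:
  assumes R: "\<And>r. r \<in> R \<Longrightarrow> openin X {r}" and g: "bij_betw g R R"
    and id: "\<And>x. x \<in> topspace X \<Longrightarrow> x \<notin> R \<Longrightarrow> g x = x"
    and fin: "\<And>C. clopenin X C \<Longrightarrow> finite {r \<in> R. (r \<in> C) \<noteq> (g r \<in> C)}"
  shows "homeomorphic_map X X g"
proof (rule continuous_imp_homeomorphic_map)
  have RX: "R \<subseteq> topspace X"
    using R openin_subset by blast
  have gR: "g r \<in> R" if "r \<in> R" for r
    using g that bij_betwE by blast
  show "compact_space X" "Hausdorff_space X"
    by (rule compact Hausdorff)+
  have "bij_betw g (topspace X - R) (topspace X - R)"
    using id by (subst bij_betw_cong[where g = id]) auto
  then have bij: "bij_betw g (R \<union> (topspace X - R)) (R \<union> (topspace X - R))"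
    using g by (intro bij_betw_combine) auto
  moreover have "R \<union> (topspace X - R) = topspace X"
    using RX by blast
  ultimately show "g ` topspace X = topspace X" "inj_on g (topspace X)"
    by (auto simp: bij_betw_def)
  show "continuous_map X X g"
  proof (rule continuous_map_clopenI)
    show "g \<in> topspace X \<rightarrow> topspace X"
      using gR id RX by fastforce
    fix C assume C: "clopenin X C"
    define P where "P = {r \<in> R. r \<in> C \<and> g r \<notin> C}"
    have "finite P"
      using fin[OF C] unfolding P_def by (rule rev_finite_subset) auto
    then have "closedin X P"
      using RX Hausdorff unfolding P_def by (intro closedin_Hausdorff_finite) auto
    then have "openin X (C - P)"
      using C clopenin_openin by blast
    moreover have "openin X (\<Union>((\<lambda>r. {r}) ` {r \<in> R. r \<notin> C \<and> g r \<in> C}))"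
      using R by (intro openin_Union) auto
    ultimately have "openin X ((C - P) \<union> \<Union>((\<lambda>r. {r}) ` {r \<in> R. r \<notin> C \<and> g r \<in> C}))"
      by (rule openin_Un)
    moreover have "{x \<in> topspace X. g x \<in> C}
        = (C - P) \<union> \<Union>((\<lambda>r. {r}) ` {r \<in> R. r \<notin> C \<and> g r \<in> C})"
    proof (rule set_eqI)
      fix x
      show "x \<in> {x \<in> topspace X. g x \<in> C}
          \<longleftrightarrow> x \<in> (C - P) \<union> \<Union>((\<lambda>r. {r}) ` {r \<in> R. r \<notin> C \<and> g r \<in> C})"
        using clopenin_subset[OF C] id[of x] RX unfolding P_def by (cases "x \<in> R") auto
    qed
    ultimately show "openin X {x \<in> topspace X. g x \<in> C}"
      by simp
  qed
qed

lemma countable_isolated: "countable {x. openin X {x}}"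
proof -
  have "clopenin X {x}" if "openin X {x}" for x
    using that Hausdorff openin_subset[OF that]
    by (auto simp: clopenin_def intro: closedin_Hausdorff_finite)
  then have "(\<lambda>x. {x}) ` {x. openin X {x}} \<subseteq> {C. clopenin X C}"
    by blast
  then have "countable ((\<lambda>x. {x}) ` {x. openin X {x}})"
    using countable_clopenin[OF compact metrizable] countable_subset by blast
  then show ?thesis
    by (rule countable_image_inj_on) auto
qed

text \<open>A derangement of the naturals that nearly preserves the traces of all clopen sets is
  transported along an enumeration of \<open>R\<close>; near invariance is what
  \<open>homeomorphic_map_permute_isolated\<close> asks for.\<close>

lemma derangement_of_isolated:
  assumes R: "\<And>r. r \<in> R \<Longrightarrow> openin X {r}" and "infinite R"
  obtains g where "bij_betw g R R" "\<And>r. r \<in> R \<Longrightarrow> g r \<noteq> r" "\<And>x. x \<notin> R \<Longrightarrow> g x = x"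
    "homeomorphic_map X X g"
proof -
  have "countable R"
    using R countable_isolated countable_subset by (metis mem_Collect_eq subsetI)
  then obtain e :: "nat \<Rightarrow> 'a" where e: "bij_betw e UNIV R"
    using \<open>infinite R\<close> bij_betw_from_nat_into by blast
  obtain f :: "nat \<Rightarrow> nat" where f: "bij f" "\<And>x. f x \<noteq> x"
      "\<And>j. finite {x. (x \<in> e -` clopens j) \<noteq> (f x \<in> e -` clopens j)}"
    using derangement_respecting_sets[of "\<lambda>j. e -` clopens j"] by blast
  define e' where "e' = inv_into UNIV e"
  have e': "bij_betw e' R UNIV" "\<And>n. e' (e n) = n" "\<And>r. r \<in> R \<Longrightarrow> e (e' r) = r"
    using e unfolding e'_def
    by (auto simp: bij_betw_inv_into bij_betw_inv_into_left bij_betw_inv_into_right)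
  define g where "g x = (if x \<in> R then e (f (e' x)) else x)" for x
  have "bij_betw (e \<circ> f \<circ> e') R R"
    using bij_betw_trans[OF e'(1) bij_betw_trans[OF f(1) e]] by (simp add: comp_assoc)
  then have bij: "bij_betw g R R"
    by (subst bij_betw_cong[where g = "e \<circ> f \<circ> e'"]) (auto simp: g_def)
  have id: "g x = x" if "x \<notin> R" for x
    using that unfolding g_def by simp
  have ne: "g r \<noteq> r" if "r \<in> R" for r
    using that f(2)[of "e' r"] e'(2) unfolding g_def by metis
  have "finite {r \<in> R. (r \<in> C) \<noteq> (g r \<in> C)}" if C: "clopenin X C" for C
  proof -
    obtain j where "C = clopens j"
      using C by (rule clopensE)
    then have "{r \<in> R. (r \<in> C) \<noteq> (g r \<in> C)} \<subseteq> e ` {x. (x \<in> e -` clopens j) \<noteq> (f x \<in> e -` clopens j)}"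
      using e'(3) unfolding g_def by (auto intro!: image_eqI[where x = "e' _"])
    then show ?thesis
      using f(3) finite_surj by blast
  qed
  then have "homeomorphic_map X X g"
    using R bij by (intro homeomorphic_map_permute_isolated[of R]) (auto simp: g_def)
  then show ?thesis
    by (intro that[OF bij ne id])
qed

end

section \<open>Periodic orbits of a homeomorphism\<close>

locale zsystem = zspace X for X :: "'a topology" +
  fixes T :: "'a \<Rightarrow> 'a"
  assumes homeo: "homeomorphic_map X X T"
begin

lemma T_in [simp, intro]: "x \<in> topspace X \<Longrightarrow> T x \<in> topspace X"
  using homeo homeomorphic_imp_surjective_map by blast

lemma funpow_in [simp, intro]: "x \<in> topspace X \<Longrightarrow> (T ^^ i) x \<in> topspace X"
  by (induction i) auto

lemma openin_funpow_preimage: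
  "openin X U \<Longrightarrow> openin X {x \<in> topspace X. (T ^^ i) x \<in> U}"
  by (metis homeo homeomorphic_map_funpow homeomorphic_imp_continuous_map
      openin_continuous_map_preimage)

definition periodic :: "'a \<Rightarrow> bool" where
  "periodic x \<longleftrightarrow> x \<in> topspace X \<and> (\<exists>k>0. (T ^^ k) x = x)"

definition orbit :: "'a \<Rightarrow> 'a set" where
  "orbit x = {(T ^^ i) x |i. True}"

lemma self_in_orbit [simp]: "x \<in> orbit x"
  unfolding orbit_def by (auto intro: exI[of _ 0])

lemma orbit_subset: "y \<in> orbit x \<Longrightarrow> orbit y \<subseteq> orbit x"
  unfolding orbit_def by (auto simp flip: funpow_add[THEN fun_cong, unfolded o_apply])

lemma funpow_multiple:
  assumes "(T ^^ k) x = x"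
  shows "(T ^^ (k * n)) x = x"
  using assms by (induction n) (auto simp: funpow_add)

lemma orbit_eq:
  assumes "periodic x" "y \<in> orbit x"
  shows "orbit y = orbit x"
proof
  show "orbit y \<subseteq> orbit x"
    using assms(2) by (rule orbit_subset)
  obtain k i where k: "k > 0" "(T ^^ k) x = x" and i: "y = (T ^^ i) x"
    using assms unfolding periodic_def orbit_def by blast
  \<comment> \<open>A multiple of the period that is at least \<open>i\<close>: from
    \<open>y\<close>, the remaining \<open>k * i - i\<close> steps lead back to
    \<open>x\<close>.\<close>
  have "i \<le> k * i"
    using k(1) by simp
  then have "(T ^^ (k * i - i)) y = (T ^^ (k * i)) x"
    unfolding i by (metis funpow_add le_add_diff_inverse2 o_apply)
  then have "(T ^^ (k * i - i)) y = x"
    using funpow_multiple[OF k(2)] by simp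
  then have "x \<in> orbit y"
    unfolding orbit_def by blast
  then show "orbit x \<subseteq> orbit y"
    by (rule orbit_subset)
qed

lemma finite_orbit:
  assumes "(T ^^ k) x = x" "k > 0"
  shows "finite (orbit x)"
proof -
  have "orbit x \<subseteq> (\<lambda>i. (T ^^ i) x) ` {..<k}"
  proof
    fix y assume "y \<in> orbit x"
    then obtain i where i: "y = (T ^^ i) x"
      unfolding orbit_def by blast
    have "y = (T ^^ (i mod k)) ((T ^^ (k * (i div k))) x)"
      unfolding i by (metis funpow_add mod_mult_div_eq o_apply)
    then show "y \<in> (\<lambda>i. (T ^^ i) x) ` {..<k}"
      using funpow_multiple[OF assms(1)] assms(2) by auto
  qed
  then show ?thesis
    using finite_surj by blast
qed

lemma periodic_funpow: "periodic x \<Longrightarrow> periodic ((T ^^ i) x)"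
  unfolding periodic_def by (metis funpow_in funpow_add add.commute o_apply)

lemma isolated_funpow: "openin X {x} \<Longrightarrow> openin X {(T ^^ i) x}"
  using homeomorphic_map_openness[OF homeomorphic_map_funpow[OF homeo], of "{x}" i]
    openin_subset by fastforce

text \<open>If the new orbit met \<open>R\<close> at \<open>q\<close>, it would continue from
  \<open>g q\<close> along \<open>T\<close>, undisturbed for fewer than \<open>k\<close> steps, as
  \<open>R\<close> has at most one point per orbit and no period below \<open>k\<close>. Closing up
  after \<open>k\<close> steps would put \<open>g q\<close> and \<open>q\<close> on one
  \<open>T\<close>-orbit, contrary to \<open>g q \<noteq> q\<close>.\<close>

lemma periods_after_permuting_orbits:
  assumes R: "\<And>r. r \<in> R \<Longrightarrow> r \<in> topspace X"
    and orbits: "\<And>a b i. a \<in> R \<Longrightarrow> b \<in> R \<Longrightarrow> (T ^^ i) a = b \<Longrightarrow> a = b"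
    and k: "k > 0" "\<And>r j. r \<in> R \<Longrightarrow> 0 < j \<Longrightarrow> j < k \<Longrightarrow> (T ^^ j) r \<noteq> r"
    and g: "\<And>r. r \<in> R \<Longrightarrow> g r \<in> R" "\<And>r. r \<in> R \<Longrightarrow> g r \<noteq> r"
      "\<And>x. x \<in> topspace X \<Longrightarrow> x \<notin> R \<Longrightarrow> g x = x"
    and x: "x \<in> topspace X" "((T \<circ> g) ^^ k) x = x"
  shows "(T ^^ k) x = x \<and> (\<forall>i. (T ^^ i) x \<notin> R)"
proof (cases "\<exists>i. ((T \<circ> g) ^^ i) x \<in> R")
  case True
  then obtain i where i: "((T \<circ> g) ^^ i) x \<in> R"
    by blast
  define q where "q = ((T \<circ> g) ^^ i) x"
  have q: "q \<in> R"
    using i unfolding q_def .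
  have "((T \<circ> g) ^^ k) q = q"
    unfolding q_def using x(2) by (metis funpow_add add.commute o_apply)
  moreover have "((T \<circ> g) ^^ Suc j) q = (T ^^ Suc j) (g q)" if "j < k" for j
    using that
  proof (induction j)
    case 0
    then show ?case by simp
  next
    case (Suc j)
    have "(T ^^ Suc j) (g q) \<notin> R"
      using orbits[of "g q" "(T ^^ Suc j) (g q)"] k(2)[of "g q" "Suc j"] g(1)[OF q] Suc.prems
      by (metis zero_less_Suc)
    then have "g ((T ^^ Suc j) (g q)) = (T ^^ Suc j) (g q)"
      using g(3) funpow_in[OF R[OF g(1)[OF q]]] by blast
    then show ?case
      using Suc by simp
  qed
  ultimately have "(T ^^ k) (g q) = q"
    using k(1) by (metis Suc_pred lessI)
  then show ?thesis
    using orbits[OF g(1)[OF q] q] g(2)[OF q] by blast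
next
  case False
  have "((T \<circ> g) ^^ i) x = (T ^^ i) x" for i
  proof (induction i)
    case (Suc i)
    then show ?case
      using False g(3)[of "(T ^^ i) x"] x(1) by (metis funpow.simps(2) o_apply funpow_in)
  qed simp
  then show ?thesis
    using False x(2) by metis
qed

text \<open>With \<open>k\<close> the smallest period of an isolated point, permuting points of
  different orbits cannot create new isolated points of period \<open>k\<close>. So the set
  \<open>N\<close> of isolated \<open>k\<close>-periodic points only loses members, although a
  conjugacy must map the remaining ones onto \<open>N\<close>.\<close>

lemma isolated_periodic_same_orbit:
  assumes hits: "\<And>x. periodic x \<Longrightarrow> \<exists>i. (T ^^ i) x \<in> M"
    and conj: "\<And>g. homeomorphic_map X X g \<Longrightarrow> (\<And>x. x \<in> topspace X \<Longrightarrow> x \<notin> M \<Longrightarrow> g x = x)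
      \<Longrightarrow> topologically_conjugate X (T \<circ> g) X T"
    and x: "openin X {x}" "periodic x" and y: "openin X {y}" "periodic y"
  shows "y \<in> orbit x"
proof (rule ccontr)
  assume neg: "y \<notin> orbit x"
  define k where "k = (LEAST k. k > 0 \<and> (\<exists>x. openin X {x} \<and> (T ^^ k) x = x))"
  have "\<exists>k. k > 0 \<and> (\<exists>x. openin X {x} \<and> (T ^^ k) x = x)"
    using x unfolding periodic_def by blast
  then have k: "k > 0" "\<exists>x. openin X {x} \<and> (T ^^ k) x = x"
    using LeastI_ex[of "\<lambda>k. k > 0 \<and> (\<exists>x. openin X {x} \<and> (T ^^ k) x = x)"] unfolding k_def by blast+
  have least: "(T ^^ j) z \<noteq> z" if "openin X {z}" "0 < j" "j < k" for z j
    using that not_less_Least[of j] unfolding k_def by blast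
  define N where "N = {z. openin X {z} \<and> (T ^^ k) z = z}"
  have NX: "N \<subseteq> topspace X"
    unfolding N_def using openin_subset by blast
  have per: "periodic z" if "z \<in> N" for z
    using that k(1) NX unfolding N_def periodic_def by blast
  \<comment> \<open>Kept general in \<open>R\<close> and \<open>g\<close>: it is used with a full
    transversal of the orbits in \<open>N\<close>, and with just two points, one of which may have a
    longer period.\<close>
  have core: "N \<subseteq> h ` {z \<in> N. \<forall>i. (T ^^ i) z \<notin> R}" if
    R: "\<And>r. r \<in> R \<Longrightarrow> openin X {r}" "R \<subseteq> M"
    and orbits: "\<And>a b i. a \<in> R \<Longrightarrow> b \<in> R \<Longrightarrow> (T ^^ i) a = b \<Longrightarrow> a = b"
    and g: "bij_betw g R R" "\<And>r. r \<in> R \<Longrightarrow> g r \<noteq> r" "\<And>x. x \<notin> R \<Longrightarrow> g x = x"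
    and h: "homeomorphic_map X X h" "\<And>x. x \<in> topspace X \<Longrightarrow> h ((T \<circ> g) x) = T (h x)"
    and gh: "homeomorphic_map X X g" for R g h
  proof
    fix z assume z: "z \<in> N"
    then have "z \<in> h ` topspace X"
      using NX h(1) homeomorphic_imp_surjective_map by blast
    then obtain w where w: "w \<in> topspace X" "z = h w"
      by blast
    have "openin X {w}"
      using homeomorphic_map_openness[OF h(1), of "{w}"] z w unfolding N_def by simp
    have gX: "g \<in> topspace X \<rightarrow> topspace X"
      using gh homeomorphic_imp_surjective_map by blast
    then have "h (((T \<circ> g) ^^ k) w) = (T ^^ k) (h w)"
      using h(2) w(1) by (intro conjugacy_funpow[where X = X]) auto
    then have "h (((T \<circ> g) ^^ k) w) = h w"
      using z w unfolding N_def by simp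
    moreover have "((T \<circ> g) ^^ i) w \<in> topspace X" for i
      using w(1) gX by (induction i) auto
    ultimately have fixed: "((T \<circ> g) ^^ k) w = w"
      using h(1) w(1) by (metis homeomorphic_imp_injective_map inj_onD)
    have gR: "g r \<in> R" if "r \<in> R" for r
      using g(1) that bij_betwE by blast
    have "(T ^^ k) w = w \<and> (\<forall>i. (T ^^ i) w \<notin> R)"
    proof (rule periods_after_permuting_orbits[OF _ orbits k(1) _ gR g(2) g(3) w(1) fixed])
      show "r \<in> topspace X" if "r \<in> R" for r
        using openin_subset[OF R(1)[OF that]] by simp
      show "(T ^^ j) r \<noteq> r" if "r \<in> R" "0 < j" "j < k" for r j
        using least[OF R(1)[OF that(1)] that(2,3)] .
    qed
    then show "z \<in> h ` {z \<in> N. \<forall>i. (T ^^ i) z \<notin> R}"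
      using w \<open>openin X {w}\<close> unfolding N_def by blast
  qed
  \<comment> \<open>The choice depends only on the orbit as a set, so \<open>R\<close> gets exactly
    one point on each orbit in \<open>N\<close>, and this point lies in \<open>M\<close>.\<close>
  define rep where "rep P = (SOME m. m \<in> P \<and> m \<in> M)" for P
  define R where "R = (\<lambda>z. rep (orbit z)) ` N"
  have rep: "rep (orbit z) \<in> orbit z" "rep (orbit z) \<in> M" if "z \<in> N" for z
  proof -
    have "\<exists>m. m \<in> orbit z \<and> m \<in> M"
      using hits[OF per[OF that]] unfolding orbit_def by blast
    then show "rep (orbit z) \<in> orbit z" "rep (orbit z) \<in> M"
      unfolding rep_def by (metis (mono_tags, lifting) someI_ex)+
  qed
  have R_iso: "openin X {r}" and RM: "r \<in> M" and R_N: "r \<in> N" if "r \<in> R" for r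
  proof -
    obtain z where z: "z \<in> N" "r = rep (orbit z)"
      using \<open>r \<in> R\<close> unfolding R_def by blast
    then obtain i where i: "r = (T ^^ i) z"
      using rep(1) unfolding orbit_def by blast
    then show iso: "openin X {r}"
      using z(1) isolated_funpow unfolding N_def by blast
    show "r \<in> M"
      using rep(2) z by blast
    have "(T ^^ k) r = r"
      using z(1) funpow_swap[of k T i z] unfolding i N_def by simp
    then show "r \<in> N"
      using iso unfolding N_def by blast
  qed
  have R_rep: "rep (orbit r) = r" if "r \<in> R" for r
    using that orbit_eq[OF per rep(1)] unfolding R_def by fastforce
  have orbits: "a = b" if "a \<in> R" "b \<in> R" "(T ^^ i) a = b" for a b i
  proof -
    have "b \<in> orbit a"
      using that(3) unfolding orbit_def by blast
    then show ?thesis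
      using orbit_eq[OF per[OF R_N[OF that(1)]]] R_rep that by metis
  qed
  show False
  proof (cases "finite R")
    \<comment> \<open>Infinitely many orbits: counting is of no use, but a derangement of the whole
      transversal destroys every orbit in \<open>N\<close>, so nothing is left to be mapped onto
      \<open>N\<close>.\<close>
    case False
    obtain g where g: "bij_betw g R R" "\<And>r. r \<in> R \<Longrightarrow> g r \<noteq> r" "\<And>x. x \<notin> R \<Longrightarrow> g x = x"
        "homeomorphic_map X X g"
      using derangement_of_isolated[of R] R_iso False by metis
    have "topologically_conjugate X (T \<circ> g) X T"
      using g RM by (intro conj) auto
    then obtain h where h: "homeomorphic_map X X h" "\<And>x. x \<in> topspace X \<Longrightarrow> h ((T \<circ> g) x) = T (h x)"
      unfolding topologically_conjugate_def by blast
    obtain z where "z \<in> N"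
      using k(2) unfolding N_def by blast
    moreover have "N \<subseteq> h ` {z \<in> N. \<forall>i. (T ^^ i) z \<notin> R}"
      by (rule core[OF R_iso _ orbits g(1-3) h g(4)]) (use RM in auto)
    ultimately obtain w where "w \<in> N" "\<forall>i. (T ^^ i) w \<notin> R"
      by blast
    then show False
      using rep(1)[of w] unfolding R_def orbit_def by force
  next
    \<comment> \<open>Finitely many orbits: \<open>N\<close> is finite, and joining one of its
      orbits to another isolated periodic orbit, of any period, removes at least one point from
      it.\<close>
    case True
    have "N \<subseteq> (\<Union>r\<in>R. orbit r)"
    proof
      fix z assume z: "z \<in> N"
      then have "z \<in> orbit (rep (orbit z))"
        using orbit_eq[OF per[OF z] rep(1)[OF z]] by simp
      then show "z \<in> (\<Union>r\<in>R. orbit r)"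
        using z unfolding R_def by blast
    qed
    moreover have "finite (orbit r)" if "r \<in> R" for r
      using finite_orbit[OF _ k(1)] R_N[OF that] unfolding N_def by blast
    ultimately have finN: "finite N"
      using True by (meson finite_UN finite_subset)
    obtain r where r: "r \<in> R"
      using k(2) unfolding N_def R_def by blast
    \<comment> \<open>\<open>x\<close> and \<open>y\<close> lie on different orbits, so at least one
      of them is off the orbit of \<open>r\<close>; it supplies the second orbit.\<close>
    have "\<not> (x \<in> orbit r \<and> y \<in> orbit r)"
      using neg orbit_eq[OF per[OF R_N[OF r]]] by metis
    then obtain p0 where p0: "openin X {p0}" "periodic p0" "p0 \<notin> orbit r"
      using x y by blast
    obtain i where i: "(T ^^ i) p0 \<in> M"
      using hits p0(2) by blast
    define p where "p = (T ^^ i) p0"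
    have p: "openin X {p}" "periodic p" "p \<in> M" "p \<in> orbit p0"
      using p0 i isolated_funpow periodic_funpow unfolding p_def orbit_def by blast+
    have "p \<notin> orbit r"
      using p0(3) orbit_eq[OF p0(2) p(4)] orbit_subset self_in_orbit by blast
    moreover have "r \<notin> orbit p"
      using calculation orbit_eq[OF p(2)] self_in_orbit by metis
    ultimately have orbits': "a = b" if "a \<in> {r, p}" "b \<in> {r, p}" "(T ^^ i) a = b" for a b i
      using that unfolding orbit_def by auto
    have rp: "r \<noteq> p"
      using \<open>p \<notin> orbit r\<close> by auto
    define g where "g z = (if z = r then p else if z = p then r else z)" for z
    have g: "bij_betw g {r, p} {r, p}" "\<And>z. z \<in> {r, p} \<Longrightarrow> g z \<noteq> z" "\<And>x. x \<notin> {r, p} \<Longrightarrow> g x = x"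
      using rp unfolding g_def bij_betw_def inj_on_def by auto
    have gh: "homeomorphic_map X X g"
      using g R_iso[OF r] p(1) by (intro homeomorphic_map_permute_isolated[of "{r, p}"]) auto
    have "topologically_conjugate X (T \<circ> g) X T"
      using RM[OF r] p(3) by (intro conj[OF gh] g(3)) auto
    then obtain h where h: "homeomorphic_map X X h" "\<And>x. x \<in> topspace X \<Longrightarrow> h ((T \<circ> g) x) = T (h x)"
      unfolding topologically_conjugate_def by blast
    have "N \<subseteq> h ` {z \<in> N. \<forall>i. (T ^^ i) z \<notin> {r, p}}"
      by (rule core[OF _ _ orbits' g h gh]) (use R_iso[OF r] p(1) RM[OF r] p(3) in auto)
    also have "\<dots> \<subseteq> h ` (N - {r})"
      by (metis (mono_tags, lifting) DiffI funpow_0 image_mono insertI1 mem_Collect_eq singletonD subsetI)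
    finally have "card N \<le> card (h ` (N - {r}))"
      using finN by (intro card_mono) auto
    also have "\<dots> \<le> card (N - {r})"
      using finN by (intro card_image_le) auto
    also have "\<dots> < card N"
      using finN R_N[OF r] by (intro card_Diff1_less)
    finally show False
      by simp
  qed
qed

end

section \<open>Perfect sets of periodic points\<close>

lemma openin_Collect_finite_ball:
  assumes "finite I" "\<And>i. i \<in> I \<Longrightarrow> openin X {x \<in> topspace X. P i x}"
  shows "openin X {x \<in> topspace X. \<forall>i\<in>I. P i x}"
  using assms
proof (induction I)
  case (insert i I)
  then have "openin X ({x \<in> topspace X. P i x} \<inter> {x \<in> topspace X. \<forall>i\<in>I. P i x})"
    by (intro openin_Int) auto
  moreover have "{x \<in> topspace X. P i x} \<inter> {x \<in> topspace X. \<forall>i\<in>I. P i x}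
      = {x \<in> topspace X. \<forall>i\<in>insert i I. P i x}"
    by auto
  ultimately show ?case
    by simp
qed simp

lemma homeomorphic_map_extend_by_identity:
  assumes C: "clopenin X C" and f: "homeomorphic_map (subtopology X C) (subtopology X C) f"
  shows "homeomorphic_map X X (\<lambda>x. if x \<in> C then f x else x)"
proof -
  let ?g = "\<lambda>f x. if x \<in> C then f x else x"
  have CX: "C \<subseteq> topspace X"
    using C by (rule clopenin_subset)
  have cont: "continuous_map X X (?g f)"
    if f: "continuous_map (subtopology X C) (subtopology X C) f" for f
    unfolding continuous_map
  proof (intro conjI allI impI)
    have fC: "f x \<in> C" if "x \<in> C" for x
      using f that CX unfolding continuous_map_def by auto
    then show "?g f ` topspace X \<subseteq> topspace X"
      using CX by auto
    fix U assume U: "openin X U"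
    have "openin (subtopology X C) {x \<in> topspace (subtopology X C). f x \<in> U \<inter> C}"
      using f U by (intro openin_continuous_map_preimage[OF f]) (auto simp: openin_subtopology)
    then have "openin X {x \<in> topspace (subtopology X C). f x \<in> U \<inter> C}"
      using C by (metis clopenin_openin openin_open_subtopology)
    moreover have "openin X (U - C)"
      using U C clopenin_closedin by blast
    ultimately have "openin X ({x \<in> topspace (subtopology X C). f x \<in> U \<inter> C} \<union> (U - C))"
      by (rule openin_Un)
    moreover have "{x \<in> topspace X. ?g f x \<in> U}
        = {x \<in> topspace (subtopology X C). f x \<in> U \<inter> C} \<union> (U - C)"
      using fC CX openin_subset[OF U] by auto
    ultimately show "openin X {x \<in> topspace X. ?g f x \<in> U}"
      by simp
  qed
  obtain f' where f': "homeomorphic_maps (subtopology X C) (subtopology X C) f f'"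
    using f homeomorphic_map_maps by blast
  then have "\<And>x. x \<in> C \<Longrightarrow> f x \<in> C \<and> f' x \<in> C \<and> f' (f x) = x \<and> f (f' x) = x"
    using CX unfolding homeomorphic_maps_def continuous_map_def by auto
  then have "homeomorphic_maps X X (?g f) (?g f')"
    using cont f' unfolding homeomorphic_maps_def by auto
  then show ?thesis
    using homeomorphic_map_maps by blast
qed

context zspace
begin

text \<open>A clopen partition into exactly \<open>N + 1\<close> nonempty pieces is written as a
  labelling. A perfect piece has two points, which a clopen set separates; one side becomes a piece
  and the other is divided further.\<close>

lemma perfect_partition:
  assumes "clopenin X K" "K \<noteq> {}" "\<And>x. x \<in> K \<Longrightarrow> \<not> openin X {x}"
  shows "\<exists>q. q ` K = {..<Suc N} \<and> (\<forall>i. clopenin X {x \<in> K. q x = i})"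
  using assms
proof (induction N arbitrary: K)
  case 0
  have "{x \<in> K. (0::nat) = i} = (if i = 0 then K else {})" for i
    by auto
  then show ?case
    using 0 by (intro exI[of _ "\<lambda>_. 0"]) (auto simp: image_constant_conv)
next
  case (Suc N)
  obtain x where x: "x \<in> K"
    using Suc.prems(2) by blast
  have "K \<noteq> {x}"
    using Suc.prems x clopenin_openin by blast
  then obtain y where y: "y \<in> K" "y \<noteq> x"
    using x by blast
  then obtain D where D: "clopenin X D" "x \<in> D" "y \<notin> D"
    using clopen_separation[of x y] x clopenin_subset[OF Suc.prems(1)] by blast
  have KD: "clopenin X (K \<inter> D)" "clopenin X (K - D)"
    using Suc.prems(1) D(1) clopenin_Int clopenin_Diff by blast+
  obtain q where q: "q ` (K \<inter> D) = {..<Suc N}" "\<And>i. clopenin X {x \<in> K \<inter> D. q x = i}"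
    using Suc.IH[OF KD(1)] x D(2) Suc.prems(3) by blast
  let ?q = "\<lambda>x. if x \<in> D then q x else Suc N"
  have "?q ` K = q ` (K \<inter> D) \<union> {Suc N}"
    using y D by (auto simp: image_iff)
  moreover have "{x \<in> K. ?q x = i} = {x \<in> K \<inter> D. q x = i} \<union> (if i = Suc N then K - D else {})" for i
    by auto
  ultimately show ?case
    using q KD(2) by (intro exI[of _ ?q]) (auto intro: clopenin_Un)
qed

text \<open>The number of pieces is at least two because \<open>D\<close> may cut \<open>K\<close>
  into two nonempty parts; hence \<open>N + 2\<close> labels.\<close>

lemma perfect_partition_respecting:
  assumes K: "clopenin X K" "K \<noteq> {}" "\<And>x. x \<in> K \<Longrightarrow> \<not> openin X {x}" and D: "clopenin X D"
  shows "\<exists>q. q ` K = {..<Suc (Suc N)} \<and> (\<forall>i. clopenin X {x \<in> K. q x = i}) \<and>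
    (\<forall>x\<in>K. \<forall>y\<in>K. q x = q y \<longrightarrow> (x \<in> D \<longleftrightarrow> y \<in> D))"
proof (cases "K \<inter> D = {} \<or> K \<subseteq> D")
  case True
  then show ?thesis
    using perfect_partition[OF K, of "Suc N"] by blast
next
  case False
  have KD: "clopenin X (K \<inter> D)" "clopenin X (K - D)"
    using K(1) D clopenin_Int clopenin_Diff by blast+
  obtain q where q: "q ` (K \<inter> D) = {..<Suc N}" "\<And>i. clopenin X {x \<in> K \<inter> D. q x = i}"
    using perfect_partition[OF KD(1), of N] False K(3) by blast
  let ?q = "\<lambda>x. if x \<in> D then q x else Suc N"
  have "?q ` K = q ` (K \<inter> D) \<union> {Suc N}"
    using False by (auto simp: image_iff)
  moreover have "{x \<in> K. ?q x = i} = {x \<in> K \<inter> D. q x = i} \<union> (if i = Suc N then K - D else {})" for i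
    by auto
  moreover have "q x \<noteq> Suc N" if "x \<in> K" "x \<in> D" for x
  proof -
    have "q x \<in> {..<Suc N}"
      using q(1) that by blast
    then show ?thesis
      by simp
  qed
  ultimately show ?thesis
    using q KD(2) by (intro exI[of _ ?q]) (auto intro: clopenin_Un dest: sym)
qed

end

text \<open>A Cantor set with alphabets of growing size: coordinate \<open>n\<close> has
  \<open>n + 2\<close> values, so coordinate \<open>Suc n\<close> has room for a cycle of length
  \<open>n + 3\<close>.\<close>

definition cantor_space :: "(nat \<Rightarrow> nat) topology" where
  "cantor_space = product_topology (\<lambda>n. discrete_topology {..<Suc (Suc n)}) UNIV"

lemma topspace_cantor_space: "topspace cantor_space = {x. \<forall>n. x n < Suc (Suc n)}"
  unfolding cantor_space_def by (auto simp: PiE_iff)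

lemma Hausdorff_cantor_space: "Hausdorff_space cantor_space"
  unfolding cantor_space_def by (simp add: Hausdorff_space_product_topology)

lemma openin_cantor_coordinate: "openin cantor_space {y \<in> topspace cantor_space. y i = a}"
proof -
  have "continuous_map cantor_space (discrete_topology {..<Suc (Suc i)}) (\<lambda>y. y i)"
    unfolding cantor_space_def by (rule continuous_map_product_projection) simp
  then have "openin cantor_space {y \<in> topspace cantor_space. y i \<in> {a} \<inter> {..<Suc (Suc i)}}"
    by (rule openin_continuous_map_preimage) auto
  moreover have "{y \<in> topspace cantor_space. y i \<in> {a} \<inter> {..<Suc (Suc i)}}
      = {y \<in> topspace cantor_space. y i = a}"
    by (auto simp: topspace_cantor_space)
  ultimately show ?thesis
    by simp
qed

text \<open>Brouwer's characterization of the Cantor set.\<close>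

lemma (in zspace) perfect_homeomorphic_cantor_space:
  assumes C: "clopenin X C" "C \<noteq> {}" and perfect: "\<And>x. x \<in> C \<Longrightarrow> \<not> openin X {x}"
  shows "\<exists>f. homeomorphic_map (subtopology X C) cantor_space f"
proof -
  \<comment> \<open>The last clause makes the label of step \<open>n\<close> decide membership in
    \<open>clopens n\<close> within a cell, which will give injectivity.\<close>
  define part where "part K n q \<longleftrightarrow> q ` K = {..<Suc (Suc n)} \<and> (\<forall>i. clopenin X {x \<in> K. q x = i}) \<and>
      (\<forall>x\<in>K. \<forall>y\<in>K. q x = q y \<longrightarrow> (x \<in> clopens n \<longleftrightarrow> y \<in> clopens n))"
    for K n and q :: "'a \<Rightarrow> nat"
  \<comment> \<open>One labelling is fixed per set \<open>K\<close>, so all points of a cell are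
    divided in the same way; \<open>same_cell\<close> and \<open>mem_cell\<close> rest on
    this.\<close>
  define q where "q K n = (SOME q. part K n q)" for K n
  have "\<exists>q. part K n q" if "clopenin X K" "K \<noteq> {}" "K \<subseteq> C" for K n
    using that perfect clopenin_clopens unfolding part_def
    by (intro perfect_partition_respecting) auto
  then have part: "part K n (q K n)" if "clopenin X K" "K \<noteq> {}" "K \<subseteq> C" for K n
    using that unfolding q_def by (metis someI_ex)
  have q: "\<And>K n. clopenin X K \<Longrightarrow> K \<noteq> {} \<Longrightarrow> K \<subseteq> C \<Longrightarrow> q K n ` K = {..<Suc (Suc n)}"
      "\<And>K n i. clopenin X K \<Longrightarrow> K \<noteq> {} \<Longrightarrow> K \<subseteq> C \<Longrightarrow> clopenin X {x \<in> K. q K n x = i}"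
      "\<And>K n x y. clopenin X K \<Longrightarrow> K \<noteq> {} \<Longrightarrow> K \<subseteq> C \<Longrightarrow> x \<in> K \<Longrightarrow> y \<in> K \<Longrightarrow> q K n x = q K n y
        \<Longrightarrow> x \<in> clopens n \<longleftrightarrow> y \<in> clopens n"
    using part[unfolded part_def] by blast+
  define cell where "cell x = rec_nat C (\<lambda>n K. {y \<in> K. q K n y = q K n x})" for x
  have cell_0: "cell x 0 = C"
    and cell_Suc: "cell x (Suc n) = {y \<in> cell x n. q (cell x n) n y = q (cell x n) n x}" for x n
    unfolding cell_def by auto
  define f where "f x n = q (cell x n) n x" for x n
  have cell: "clopenin X (cell x n)" "x \<in> cell x n" "cell x n \<subseteq> C" if "x \<in> C" for x n
    using that C(1) by (induction n) (auto simp: cell_0 cell_Suc intro: q(2))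
  have cell_ne: "cell x n \<noteq> {}" if "x \<in> C" for x n
    using cell(2)[OF that] by blast
  have same_cell: "cell y n = cell x n" if "y \<in> cell x n" for x y n
    using that by (induction n) (auto simp: cell_0 cell_Suc)
  have mem_cell: "y \<in> cell x n \<longleftrightarrow> y \<in> C \<and> (\<forall>i<n. f y i = f x i)" for x y n
  proof (induction n)
    case (Suc n)
    then show ?case
      using same_cell[of y x n] unfolding cell_Suc f_def less_Suc_eq by auto
  qed (simp add: cell_0)
  have f_lt: "f x n < Suc (Suc n)" if "x \<in> C" for x n
    using q(1)[OF cell(1)[OF that] cell_ne[OF that] cell(3)[OF that], of n n] cell(2)[OF that, of n]
    unfolding f_def by blast
  have top: "topspace (subtopology X C) = C"
    using clopenin_subset[OF C(1)] by auto
  have "homeomorphic_map (subtopology X C) cantor_space f"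
  proof (rule continuous_imp_homeomorphic_map)
    show "compact_space (subtopology X C)"
      using compact C(1) clopenin_closedin closedin_compact_space compact_space_subtopology by blast
    show "Hausdorff_space cantor_space"
      by (rule Hausdorff_cantor_space)
    have "continuous_map (subtopology X C) (discrete_topology {..<Suc (Suc n)}) (\<lambda>x. f x n)" for n
      unfolding continuous_map top
    proof (intro conjI allI impI)
      show "(\<lambda>x. f x n) ` C \<subseteq> topspace (discrete_topology {..<Suc (Suc n)})"
        using f_lt by auto
      fix U :: "nat set"
      have "openin X {x \<in> C. f x n \<in> U}"
        unfolding openin_iff_clopen_nbhd
      proof
        fix x assume x: "x \<in> {x \<in> C. f x n \<in> U}"
        then have "cell x (Suc n) \<subseteq> {x \<in> C. f x n \<in> U}"
          unfolding mem_cell subset_iff by auto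
        then show "\<exists>D. clopenin X D \<and> x \<in> D \<and> D \<subseteq> {x \<in> C. f x n \<in> U}"
          using cell[of x "Suc n"] x by blast
      qed
      then show "openin (subtopology X C) {x \<in> C. f x n \<in> U}"
        unfolding openin_subtopology by blast
    qed
    then show "continuous_map (subtopology X C) cantor_space f"
      unfolding cantor_space_def by (simp add: continuous_map_componentwise_UNIV)
    show "inj_on f (topspace (subtopology X C))"
      unfolding top
    proof (rule inj_onI)
      fix x y assume xy: "x \<in> C" "y \<in> C" "f x = f y"
      have "x \<in> clopens n \<longleftrightarrow> y \<in> clopens n" for n
      proof -
        have y: "y \<in> cell x n"
          using xy by (simp add: mem_cell)
        moreover have "q (cell x n) n x = q (cell x n) n y"
          using fun_cong[OF xy(3), of n] same_cell[OF y] unfolding f_def by simp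
        ultimately show ?thesis
          using q(3)[OF cell(1)[OF xy(1)] cell_ne[OF xy(1)] cell(3)[OF xy(1)] cell(2)[OF xy(1)]]
          by blast
      qed
      then show "x = y"
        using eq_if_same_clopens clopenin_subset[OF C(1)] xy by blast
    qed
    show "f ` topspace (subtopology X C) = topspace cantor_space"
      unfolding top
    proof
      show "f ` C \<subseteq> topspace cantor_space"
        using f_lt by (auto simp: topspace_cantor_space)
      show "topspace cantor_space \<subseteq> f ` C"
      proof
        fix p assume p: "p \<in> topspace cantor_space"
        \<comment> \<open>Each \<open>K n\<close> turns out to be one of the cells, hence clopen and
          nonempty; compactness then supplies a preimage of \<open>p\<close>.\<close>
        define K where "K n = {x \<in> C. \<forall>i<n. f x i = p i}" for n
        have ne: "K n \<noteq> {}" for n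
        proof (induction n)
          case 0
          then show ?case
            using C(2) by (simp add: K_def)
        next
          case (Suc n)
          then obtain x where x: "x \<in> C" "\<And>i. i < n \<Longrightarrow> f x i = p i"
            unfolding K_def by blast
          have "p n \<in> q (cell x n) n ` cell x n"
            using q(1)[OF cell(1)[OF x(1)] cell_ne[OF x(1)] cell(3)[OF x(1)]] p
            by (auto simp: topspace_cantor_space)
          then obtain y where y: "y \<in> cell x n" "p n = q (cell x n) n y"
            by blast
          then have "y \<in> K (Suc n)"
            using x(2) same_cell[OF y(1)] unfolding K_def mem_cell less_Suc_eq by (auto simp: f_def)
          then show ?case
            by blast
        qed
        have "(\<Inter>n. K n) \<noteq> {}"
        proof (rule clopen_nest)
          fix n
          obtain x where "x \<in> K n"
            using ne by blast
          then have "x \<in> C" "K n = cell x n"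
            unfolding K_def mem_cell set_eq_iff by auto
          then show "clopenin X (K n)"
            using cell(1) by simp
          show "K (Suc n) \<subseteq> K n"
            unfolding K_def by auto
        qed (rule ne)
        then obtain x where x: "\<And>n. x \<in> K n"
          by blast
        have "f x n = p n" for n
          using x[of "Suc n"] unfolding K_def by simp
        then have "p = f x"
          by auto
        moreover have "x \<in> C"
          using x[of 0] unfolding K_def by blast
        ultimately show "p \<in> f ` C"
          by blast
      qed
    qed
  qed
  then show ?thesis
    by (intro exI[where x = f])
qed

section \<open>Homeomorphisms of the Cantor set with prescribed periods\<close>

definition first_nonzero :: "(nat \<Rightarrow> nat) \<Rightarrow> nat \<Rightarrow> bool" where
  "first_nonzero x n \<longleftrightarrow> x n \<noteq> 0 \<and> (\<forall>i<n. x i = 0)"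

text \<open>On the piece of sequences whose first nonzero coordinate is \<open>n\<close>, with
  \<open>n \<in> Q\<close>, coordinate \<open>n + 1\<close> is rotated by \<open>c n\<close> modulo
  its \<open>n + 3\<close> values; all else is fixed. Allowing any \<open>c\<close> makes iterates
  and the inverse instances of one formula.\<close>

definition rotation :: "nat set \<Rightarrow> (nat \<Rightarrow> nat) \<Rightarrow> (nat \<Rightarrow> nat) \<Rightarrow> (nat \<Rightarrow> nat)" where
  "rotation Q c x j = (case j of 0 \<Rightarrow> x 0
     | Suc n \<Rightarrow> if first_nonzero x n \<and> n \<in> Q then (x (Suc n) + c n) mod (n + 3) else x (Suc n))"

lemma first_nonzero_unique: "first_nonzero x n \<Longrightarrow> first_nonzero x m \<Longrightarrow> n = m"
  unfolding first_nonzero_def by (metis linorder_neqE_nat)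

text \<open>The only coordinate that can change comes right after the first nonzero one, so the
  pieces are invariant.\<close>

lemma first_nonzero_rotation: "first_nonzero (rotation Q c x) n \<longleftrightarrow> first_nonzero x n"
proof -
  have *: "first_nonzero (rotation Q c x) n" if n: "first_nonzero x n" for n
  proof -
    have "rotation Q c x i = x i" if "i \<le> n" for i
      using that first_nonzero_unique[OF n, of "i - 1"] unfolding rotation_def by (auto split: nat.split)
    then show ?thesis
      using n unfolding first_nonzero_def by auto
  qed
  show ?thesis
  proof (cases "\<exists>m. first_nonzero x m")
    case True
    then show ?thesis
      using * first_nonzero_unique by metis
  next
    case False
    then have "rotation Q c x = x"
      unfolding rotation_def by (auto split: nat.split)
    then show ?thesis
      by simp
  qed
qed

lemma rotation_rotation: "rotation Q c (rotation Q d x) = rotation Q (\<lambda>n. c n + d n) x"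
proof
  fix j
  show "rotation Q c (rotation Q d x) j = rotation Q (\<lambda>n. c n + d n) x j"
  proof (cases j)
    case (Suc n)
    then show ?thesis
      by (simp add: rotation_def[of Q c "rotation Q d x"] first_nonzero_rotation)
        (simp add: rotation_def mod_add_right_eq mod_add_left_eq ac_simps)
  qed (simp add: rotation_def)
qed

lemma rotation_in:
  assumes "x \<in> topspace cantor_space"
  shows "rotation Q c x \<in> topspace cantor_space"
proof -
  have "rotation Q c x j < Suc (Suc j)" for j
  proof (cases j)
    case (Suc n)
    have "a mod (n + 3) < n + 3" for a
      by simp
    then have "a mod (n + 3) < Suc (Suc (Suc n))" for a
      by (metis add.commute add_Suc numeral_3_eq_3 plus_nat.add_0)
    then show ?thesis
      using assms Suc by (simp add: rotation_def topspace_cantor_space)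
  qed (use assms in \<open>simp add: rotation_def topspace_cantor_space\<close>)
  then show ?thesis
    by (simp add: topspace_cantor_space)
qed

lemma rotation_full:
  assumes "x \<in> topspace cantor_space" "\<And>n. (n + 3) dvd c n"
  shows "rotation Q c x = x"
proof
  fix j
  show "rotation Q c x j = x j"
  proof (cases j)
    case (Suc n)
    have "x (Suc n) < n + 3"
      using assms(1) by (auto simp: topspace_cantor_space numeral_3_eq_3)
    moreover have "(x (Suc n) + c n) mod (n + 3) = x (Suc n) mod (n + 3)"
      using assms(2)[of n] by (metis add.right_neutral mod_add_right_eq mod_eq_0_iff_dvd)
    ultimately show ?thesis
      using Suc by (simp add: rotation_def)
  qed (simp add: rotation_def)
qed

lemma rotation_funpow:
  assumes "x \<in> topspace cantor_space"
  shows "(rotation Q (\<lambda>_. 1) ^^ a) x = rotation Q (\<lambda>_. a) x"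
proof (induction a)
  case 0
  then show ?case
    using rotation_full[OF assms, of "\<lambda>_. 0"] by simp
qed (simp add: rotation_rotation)

lemma continuous_map_rotation: "continuous_map cantor_space cantor_space (rotation Q c)"
proof -
  have "continuous_map cantor_space (discrete_topology {..<Suc (Suc j)}) (\<lambda>x. rotation Q c x j)" for j
    unfolding continuous_map
  proof (intro conjI allI impI)
    show "(\<lambda>x. rotation Q c x j) ` topspace cantor_space \<subseteq> topspace (discrete_topology {..<Suc (Suc j)})"
      using rotation_in by (auto simp: topspace_cantor_space)
    fix U :: "nat set"
    show "openin cantor_space {x \<in> topspace cantor_space. rotation Q c x j \<in> U}"
    proof (subst openin_subopen, intro ballI)
      fix x assume x: "x \<in> {x \<in> topspace cantor_space. rotation Q c x j \<in> U}"
      define N where "N = {y \<in> topspace cantor_space. \<forall>i\<in>{..j}. y i = x i}"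
      have "openin cantor_space N"
        unfolding N_def by (intro openin_Collect_finite_ball openin_cantor_coordinate) simp
      have "rotation Q c y j = rotation Q c x j" if "y \<in> N" for y
      proof (cases j)
        case (Suc n)
        then have "first_nonzero y n = first_nonzero x n" "y (Suc n) = x (Suc n)"
          using that unfolding N_def first_nonzero_def by auto
        then show ?thesis
          using Suc by (simp add: rotation_def)
      qed (use that in \<open>simp add: N_def rotation_def\<close>)
      moreover have "N \<subseteq> topspace cantor_space"
        unfolding N_def by blast
      ultimately have "N \<subseteq> {x \<in> topspace cantor_space. rotation Q c x j \<in> U}"
        using x by auto
      moreover have "x \<in> N"
        using x unfolding N_def by auto
      ultimately show "\<exists>N. openin cantor_space N \<and> x \<in> N \<and>
          N \<subseteq> {x \<in> topspace cantor_space. rotation Q c x j \<in> U}"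
        using \<open>openin cantor_space N\<close> by blast
    qed
  qed
  then show ?thesis
    unfolding cantor_space_def by (simp add: continuous_map_componentwise_UNIV)
qed

lemma homeomorphic_map_rotation: "homeomorphic_map cantor_space cantor_space (rotation Q (\<lambda>_. 1))"
proof -
  \<comment> \<open>\<open>n + 2\<close> is -1 modulo \<open>n + 3\<close>, which gives the
    inverse.\<close>
  have "homeomorphic_maps cantor_space cantor_space (rotation Q (\<lambda>_. 1)) (rotation Q (\<lambda>n. n + 2))"
    unfolding homeomorphic_maps_def
    by (auto simp: continuous_map_rotation rotation_rotation numeral_3_eq_3 intro!: rotation_full)
  then show ?thesis
    using homeomorphic_map_maps by blast
qed

definition least_period :: "('a \<Rightarrow> 'a) \<Rightarrow> nat \<Rightarrow> 'a \<Rightarrow> bool" where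
  "least_period f m x \<longleftrightarrow> m > 0 \<and> (f ^^ m) x = x \<and> (\<forall>j. 0 < j \<and> j < m \<longrightarrow> (f ^^ j) x \<noteq> x)"

text \<open>The piece with first nonzero coordinate \<open>n\<close> consists of cycles of length
  \<open>n + 3\<close> if \<open>n \<in> Q\<close> and of fixed points otherwise.\<close>

lemma least_periods_rotation:
  "(\<exists>x\<in>topspace cantor_space. least_period (rotation Q (\<lambda>_. 1)) (n + 3) x) \<longleftrightarrow> n \<in> Q"
proof
  assume n: "n \<in> Q"
  define x where "x j = (if j = n then 1 else 0 :: nat)" for j
  have x: "x \<in> topspace cantor_space"
    by (auto simp: x_def topspace_cantor_space)
  have "rotation Q (\<lambda>_. a) x (Suc n) = a mod (n + 3)" for a
    using n unfolding rotation_def first_nonzero_def x_def by simp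
  moreover have "rotation Q (\<lambda>_. n + 3) x j = x j" for j
  proof -
    have "first_nonzero x m \<longleftrightarrow> m = n" for m
      unfolding first_nonzero_def x_def by simp
    then show ?thesis
      by (cases j) (simp_all add: rotation_def x_def)
  qed
  ultimately have "least_period (rotation Q (\<lambda>_. 1)) (n + 3) x"
    unfolding least_period_def rotation_funpow[OF x]
    by (auto simp: x_def fun_eq_iff) (metis mod_less n_not_Suc_n nat_neq_iff)
  then show "\<exists>x\<in>topspace cantor_space. least_period (rotation Q (\<lambda>_. 1)) (n + 3) x"
    using x by blast
next
  assume "\<exists>x\<in>topspace cantor_space. least_period (rotation Q (\<lambda>_. 1)) (n + 3) x"
  then obtain x where x: "x \<in> topspace cantor_space" and "least_period (rotation Q (\<lambda>_. 1)) (n + 3) x"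
    by blast
  then have fixed: "rotation Q (\<lambda>_. n + 3) x = x"
    and least: "\<And>j. 0 < j \<Longrightarrow> j < n + 3 \<Longrightarrow> rotation Q (\<lambda>_. j) x \<noteq> x"
    unfolding least_period_def rotation_funpow[OF x] by blast+
  \<comment> \<open>As \<open>1 < n + 3\<close>, the point \<open>x\<close> is moved and lies in
    some rotating piece \<open>m\<close>. Its cycle length \<open>m + 3\<close> then equals
    \<open>n + 3\<close>, by minimality on one side and divisibility on the other.\<close>
  obtain j where j: "rotation Q (\<lambda>_. 1) x j \<noteq> x j"
    using least[of 1] by (auto simp: fun_eq_iff)
  then obtain m where "j = Suc m"
    by (cases j) (auto simp: rotation_def)
  then have m: "first_nonzero x m" "m \<in> Q"
    using j by (auto simp: rotation_def split: if_splits)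
  have "rotation Q (\<lambda>_. m + 3) x j = x j" for j
  proof (cases j)
    case (Suc i)
    have "x (Suc i) < i + 3"
      using x by (auto simp: topspace_cantor_space numeral_3_eq_3)
    then show ?thesis
      using first_nonzero_unique[OF m(1)] Suc by (auto simp: rotation_def)
  qed (simp add: rotation_def)
  then have "n \<le> m"
    using least[of "m + 3"] by (auto simp: fun_eq_iff not_less[symmetric])
  have lt: "x (Suc m) < m + 3"
    using x by (auto simp: topspace_cantor_space numeral_3_eq_3)
  have "(x (Suc m) + (n + 3)) mod (m + 3) = x (Suc m)"
    using fun_cong[OF fixed, of "Suc m"] m by (simp add: rotation_def)
  then have "(x (Suc m) + (n + 3)) mod (m + 3) = (x (Suc m) + 0) mod (m + 3)"
    using lt by simp
  then have "(n + 3) mod (m + 3) = 0 mod (m + 3)"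
    by (metis add.commute cancel_comm_monoid_add_class.diff_cancel diff_add_inverse mod_0 mod_eq_dvd_iff_nat dvd_eq_mod_eq_0 le_add1 add.right_neutral)
  then have "m = n"
    using \<open>n \<le> m\<close> by (metis add_le_cancel_right dvd_imp_le le_antisym mod_0 mod_eq_0_iff_dvd zero_less_numeral trans_less_add2)
  then show "n \<in> Q"
    using m by simp
qed

lemma least_period_conjugate:
  assumes h: "\<And>x. x \<in> A \<Longrightarrow> h (f x) = g (h x)" and f: "f \<in> A \<rightarrow> A" and inj: "inj_on h A" and x: "x \<in> A"
  shows "least_period g m (h x) \<longleftrightarrow> least_period f m x"
proof -
  have fA: "(f ^^ i) x \<in> A" for i
    using f x by (induction i) auto
  have "h ((f ^^ i) x) = (g ^^ i) (h x)" for i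
    using fA h by (induction i) auto
  then have "(g ^^ i) (h x) = h x \<longleftrightarrow> (f ^^ i) x = x" for i
    using inj x fA by (metis inj_onD)
  then show ?thesis
    unfolding least_period_def by simp
qed

text \<open>\<open>C\<close> is the base of a tower of height \<open>k\<close> on which
  \<open>T\<close> returns identically. With \<open>g\<close> inserted at the base, one round takes
  \<open>k\<close> steps and has net effect \<open>g\<close>, and at times that are not multiples of
  \<open>k\<close> the orbit is off \<open>C\<close>; so periods of base points are multiplied by
  \<open>k\<close>.\<close>

lemma least_period_tower:
  assumes k: "k > 0" and g: "\<And>x. x \<in> C \<Longrightarrow> g x \<in> C" "\<And>x. x \<in> X \<Longrightarrow> x \<notin> C \<Longrightarrow> g x = x"
    and T: "\<And>x. x \<in> X \<Longrightarrow> T x \<in> X" "C \<subseteq> X"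
    and tower: "\<And>x. x \<in> C \<Longrightarrow> (T ^^ k) x = x" "\<And>x j. x \<in> C \<Longrightarrow> 0 < j \<Longrightarrow> j < k \<Longrightarrow> (T ^^ j) x \<notin> C"
    and x: "x \<in> C"
  shows "least_period (T \<circ> g) (k * m) x \<longleftrightarrow> least_period g m x"
proof -
  have TX: "(T ^^ j) x \<in> X" if "x \<in> X" for j x
    using that T(1) by (induction j) auto
  have climb: "((T \<circ> g) ^^ Suc j) x = (T ^^ Suc j) (g x)" if "x \<in> C" "j < k" for j x
    using that(2)
  proof (induction j)
    case (Suc j)
    have "g ((T ^^ Suc j) (g x)) = (T ^^ Suc j) (g x)"
      using Suc.prems g(1)[OF that(1)] T(2) tower(2)[of "g x" "Suc j"] by (intro g(2) TX) auto
    then show ?case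
      using Suc by simp
  qed simp
  have around: "((T \<circ> g) ^^ k) x = g x" if "x \<in> C" for x
    using climb[OF that, of "k - 1"] k tower(1)[OF g(1)[OF that]] by (simp del: funpow.simps)
  have gC: "(g ^^ a) x \<in> C" for a
    using x g(1) by (induction a) auto
  have multiple: "((T \<circ> g) ^^ (k * a)) x = (g ^^ a) x" for a
  proof (induction a)
    case (Suc a)
    have "((T \<circ> g) ^^ (k * Suc a)) x = ((T \<circ> g) ^^ k) (((T \<circ> g) ^^ (k * a)) x)"
      by (simp add: funpow_add del: funpow.simps)
    also have "\<dots> = g ((g ^^ a) x)"
      unfolding Suc.IH by (rule around[OF gC])
    also have "\<dots> = (g ^^ Suc a) x"
      by simp
    finally show ?case .
  qed simp
  have off: "((T \<circ> g) ^^ j) x \<noteq> x" if "\<not> k dvd j" for j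
  proof -
    have "0 < j mod k"
      using that by (simp add: mod_greater_zero_iff_not_dvd)
    then obtain b where b: "j mod k = Suc b"
      by (metis Suc_pred)
    have bk: "Suc b < k"
      using k b by (metis mod_less_divisor)
    have "((T \<circ> g) ^^ j) x = ((T \<circ> g) ^^ Suc b) (((T \<circ> g) ^^ (k * (j div k))) x)"
      using b by (metis funpow_add mod_mult_div_eq o_apply)
    also have "\<dots> = (T ^^ Suc b) (g ((g ^^ (j div k)) x))"
      unfolding multiple using bk by (intro climb gC) simp
    also have "\<dots> \<notin> C"
      using bk by (intro tower(2) g(1) gC) auto
    finally show ?thesis
      using x by metis
  qed
  show ?thesis
  proof
    assume *: "least_period (T \<circ> g) (k * m) x"
    have "(g ^^ j) x \<noteq> x" if "0 < j" "j < m" for j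
      using * that k unfolding least_period_def multiple[symmetric] by auto
    then show "least_period g m x"
      using * unfolding least_period_def multiple by auto
  next
    assume *: "least_period g m x"
    have "((T \<circ> g) ^^ j) x \<noteq> x" if j: "0 < j" "j < k * m" for j
    proof (cases "k dvd j")
      case True
      then obtain a where "j = k * a" ..
      then show ?thesis
        using * j multiple unfolding least_period_def by auto
    qed (rule off)
    then show "least_period (T \<circ> g) (k * m) x"
      using * k unfolding least_period_def multiple by auto
  qed
qed

lemma uncountable_nat_sets: "\<not> countable (UNIV :: nat set set)"
proof
  assume "countable (UNIV :: nat set set)"
  then have "range (from_nat_into (UNIV :: nat set set)) = UNIV"
    by (intro range_from_nat_into) auto
  then show False
    using Cantors_theorem[of "UNIV :: nat set"] by (metis Pow_UNIV)
qed

context zsystem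
begin

text \<open>Modifying \<open>T\<close> on \<open>C\<close> yields uncountably many systems told apart by the periods met in the clopen
  set \<open>C\<close>, whereas \<open>X\<close> has only countably many clopen sets.\<close>

lemma no_perfect_periodic_tower:
  assumes C: "clopenin X C" "C \<noteq> {}" and perfect: "\<And>x. x \<in> C \<Longrightarrow> \<not> openin X {x}"
    and k: "k > 0" and tower: "\<And>x. x \<in> C \<Longrightarrow> (T ^^ k) x = x"
      "\<And>x j. x \<in> C \<Longrightarrow> 0 < j \<Longrightarrow> j < k \<Longrightarrow> (T ^^ j) x \<notin> C"
    and conj: "\<And>g. homeomorphic_map X X g \<Longrightarrow> (\<And>x. x \<in> topspace X \<Longrightarrow> x \<notin> C \<Longrightarrow> g x = x)
      \<Longrightarrow> topologically_conjugate X (T \<circ> g) X T"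
  shows False
proof -
  have CX: "C \<subseteq> topspace X"
    using C(1) by (rule clopenin_subset)
  obtain f f' where f: "homeomorphic_maps (subtopology X C) cantor_space f f'"
    using perfect_homeomorphic_cantor_space[OF C perfect] homeomorphic_map_maps by blast
  have ff': "f (f' y) = y" "f' y \<in> C" if "y \<in> topspace cantor_space" for y
    using f that CX unfolding homeomorphic_maps_def continuous_map_def by auto
  have f'f: "f' (f x) = x" "f x \<in> topspace cantor_space" if "x \<in> C" for x
    using f that CX unfolding homeomorphic_maps_def continuous_map_def by auto
  define rot where "rot Q = f' \<circ> (rotation Q (\<lambda>_. 1) \<circ> f)" for Q
  have rot_C: "rot Q x \<in> C" if "x \<in> C" for Q x
    using that ff' f'f rotation_in unfolding rot_def by simp
  have rot: "homeomorphic_map (subtopology X C) (subtopology X C) (rot Q)" for Q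
    unfolding rot_def using f homeomorphic_map_rotation homeomorphic_maps_map
    by (metis homeomorphic_map_compose)
  define g where "g Q x = (if x \<in> C then rot Q x else x)" for Q x
  have g: "homeomorphic_map X X (g Q)" for Q
    unfolding g_def[abs_def] using homeomorphic_map_extend_by_identity[OF C(1) rot] .
  have "topologically_conjugate X (T \<circ> g Q) X T" for Q
    by (rule conj[OF g]) (simp add: g_def)
  then obtain h where h: "\<And>Q. homeomorphic_map X X (h Q)"
      "\<And>Q x. x \<in> topspace X \<Longrightarrow> h Q ((T \<circ> g Q) x) = T (h Q x)"
    unfolding topologically_conjugate_def by metis
  \<comment> \<open>The right side mentions only \<open>T\<close> and the image of \<open>C\<close>
    under \<open>h Q\<close>, so \<open>Q\<close> can be recovered from that clopen set.\<close>
  have "n \<in> Q \<longleftrightarrow> (\<exists>y\<in>h Q ` C. least_period T (k * (n + 3)) y)" for n Q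
  proof -
    have "n \<in> Q \<longleftrightarrow> (\<exists>y\<in>topspace cantor_space. least_period (rotation Q (\<lambda>_. 1)) (n + 3) y)"
      by (rule least_periods_rotation[symmetric])
    also have "\<dots> \<longleftrightarrow> (\<exists>x\<in>C. least_period (rotation Q (\<lambda>_. 1)) (n + 3) (f x))"
      using ff' f'f by metis
    also have "\<dots> \<longleftrightarrow> (\<exists>x\<in>C. least_period (g Q) (n + 3) x)"
    proof (rule bex_cong[OF refl], rule least_period_conjugate[where A = C])
      show "inj_on f C"
        by (rule inj_on_inverseI[of _ f']) (rule f'f(1))
      show "g Q \<in> C \<rightarrow> C"
        using rot_C by (auto simp: g_def)
      show "f (g Q x) = rotation Q (\<lambda>_. 1) (f x)" if "x \<in> C" for x
        using that ff' f'f rotation_in by (simp add: g_def rot_def)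
    qed
    also have "\<dots> \<longleftrightarrow> (\<exists>x\<in>C. least_period (T \<circ> g Q) (k * (n + 3)) x)"
      using k tower CX rot_C
      by (intro bex_cong[OF refl] least_period_tower[where X = "topspace X" and C = C, symmetric])
        (auto simp: g_def)
    also have "\<dots> \<longleftrightarrow> (\<exists>x\<in>C. least_period T (k * (n + 3)) (h Q x))"
    proof (rule bex_cong[OF refl], rule least_period_conjugate[where A = "topspace X", symmetric])
      show "inj_on (h Q) (topspace X)"
        using h(1) homeomorphic_imp_injective_map by blast
      show "T \<circ> g Q \<in> topspace X \<rightarrow> topspace X"
        using subsetD[OF CX rot_C] by (auto simp: g_def)
    qed (use h(2) CX in auto)
    finally show ?thesis
      by auto
  qed
  then have "inj (\<lambda>Q. h Q ` C)"
    by (intro injI) (metis set_eqI)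
  moreover have "range (\<lambda>Q. h Q ` C) \<subseteq> {D. clopenin X D}"
    using clopenin_image[OF h(1) C(1)] by blast
  then have "countable (range (\<lambda>Q. h Q ` C))"
    using countable_clopenin[OF compact metrizable] countable_subset by blast
  ultimately show False
    using uncountable_nat_sets countable_image_inj_on by blast
qed

lemma closedin_fixed: "closedin X {x \<in> topspace X. (T ^^ n) x = x}"
  using closedin_continuous_maps_eq[OF Hausdorff, of X "T ^^ n" id]
    homeomorphic_imp_continuous_map[OF homeomorphic_map_funpow[OF homeo]]
  by simp

text \<open>The tower is found by shrinking an open set: first \<open>T ^^ k\<close> is the identity
  on it with \<open>k\<close> as small as possible, then it is disjoint from its next
  \<open>k - 1\<close> images, and finally one fixed power of \<open>T\<close> carries it into
  \<open>M\<close>.\<close>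

lemma no_perfect_periodic_open:
  assumes M: "closedin X M" and hits: "\<And>x. periodic x \<Longrightarrow> \<exists>i. (T ^^ i) x \<in> M"
    and conj: "\<And>g. homeomorphic_map X X g \<Longrightarrow> (\<And>x. x \<in> topspace X \<Longrightarrow> x \<notin> M \<Longrightarrow> g x = x)
      \<Longrightarrow> topologically_conjugate X (T \<circ> g) X T"
    and V: "openin X V" "V \<noteq> {}"
  shows "\<exists>x\<in>V. openin X {x} \<or> \<not> periodic x"
proof (rule ccontr)
  assume "\<not> ?thesis"
  then have per: "\<And>x. x \<in> V \<Longrightarrow> periodic x" and perfect: "\<And>x. x \<in> V \<Longrightarrow> \<not> openin X {x}"
    by blast+
  define good where
    "good k \<longleftrightarrow> k > 0 \<and> (\<exists>W. openin X W \<and> W \<noteq> {} \<and> W \<subseteq> V \<and> (\<forall>x\<in>W. (T ^^ k) x = x))" for k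
  have "\<exists>n W. openin X W \<and> W \<noteq> {} \<and> W \<subseteq> V \<and> W \<subseteq> {x \<in> topspace X. (T ^^ Suc n) x = x}"
  proof (rule Baire_open[OF V])
    show "V \<subseteq> (\<Union>n. {x \<in> topspace X. (T ^^ Suc n) x = x})"
      using per unfolding periodic_def by (auto simp del: funpow.simps) (metis Suc_pred)
  qed (rule closedin_fixed)
  then have "\<exists>k. good k"
    unfolding good_def by blast
  define k where "k = (LEAST k. good k)"
  have "good k"
    unfolding k_def using \<open>\<exists>k. good k\<close> by (rule LeastI_ex)
  then obtain W where k: "k > 0" and W: "openin X W" "W \<noteq> {}" "W \<subseteq> V"
      "\<And>x. x \<in> W \<Longrightarrow> (T ^^ k) x = x"
    unfolding good_def by blast
  \<comment> \<open>Otherwise the closed sets of points fixed by smaller powers would cover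
    \<open>W\<close>, and Baire category would give a good number below \<open>k\<close>.\<close>
  have "\<exists>x\<in>W. \<forall>j\<in>{0<..<k}. (T ^^ j) x \<noteq> x"
  proof (rule ccontr)
    assume no: "\<not> ?thesis"
    define F where "F n = (if 0 < n \<and> n < k then {x \<in> topspace X. (T ^^ n) x = x} else {})" for n
    have "\<exists>n W'. openin X W' \<and> W' \<noteq> {} \<and> W' \<subseteq> W \<and> W' \<subseteq> F n"
    proof (rule Baire_open[OF W(1,2)])
      show "W \<subseteq> (\<Union>n. F n)"
        using no openin_subset[OF W(1)] unfolding F_def by fastforce
      show "closedin X (F n)" for n
        using closedin_fixed unfolding F_def by simp
    qed
    then obtain n W' where W': "openin X W'" "W' \<noteq> {}" "W' \<subseteq> W" "W' \<subseteq> F n"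
      by blast
    then have "0 < n" "n < k" "\<forall>x\<in>W'. (T ^^ n) x = x"
      unfolding F_def by (auto split: if_splits)
    then have "good n"
      using W' W(3) unfolding good_def by blast
    then show False
      using \<open>n < k\<close> not_less_Least unfolding k_def by blast
  qed
  then obtain x where x: "x \<in> W" "\<And>j. j \<in> {0<..<k} \<Longrightarrow> (T ^^ j) x \<noteq> x"
    by blast
  have xX: "x \<in> topspace X"
    using x(1) openin_subset[OF W(1)] by blast
  have "\<exists>E. clopenin X E \<and> x \<in> E \<and> (T ^^ j) x \<notin> E" if "j \<in> {0<..<k}" for j
    using x(2)[OF that] clopen_separation[OF xX funpow_in[OF xX]] by metis
  then obtain E where E: "\<And>j. j \<in> {0<..<k} \<Longrightarrow> clopenin X (E j) \<and> x \<in> E j \<and> (T ^^ j) x \<notin> E j"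
    by metis
  define W2 where "W2 = W \<inter> {y \<in> topspace X. \<forall>j\<in>{0<..<k}. y \<in> E j \<and> (T ^^ j) y \<notin> E j}"
  have "openin X {y \<in> topspace X. y \<in> E j \<and> (T ^^ j) y \<notin> E j}" if "j \<in> {0<..<k}" for j
  proof -
    have "openin X (E j \<inter> {y \<in> topspace X. (T ^^ j) y \<in> topspace X - E j})"
      using E[OF that] clopenin_openin clopenin_closedin
      by (intro openin_Int openin_funpow_preimage) blast+
    moreover have "E j \<inter> {y \<in> topspace X. (T ^^ j) y \<in> topspace X - E j}
        = {y \<in> topspace X. y \<in> E j \<and> (T ^^ j) y \<notin> E j}"
      by auto
    ultimately show ?thesis
      by simp
  qed
  then have "openin X W2"
    unfolding W2_def using W(1) by (intro openin_Int openin_Collect_finite_ball) auto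
  moreover have "x \<in> W2"
    using x(1) xX E unfolding W2_def by blast
  moreover have "W2 \<subseteq> (\<Union>i. {y \<in> topspace X. (T ^^ i) y \<in> M})"
  proof
    fix y assume "y \<in> W2"
    then have y: "y \<in> topspace X" "y \<in> V"
      using W(3) unfolding W2_def by blast+
    then show "y \<in> (\<Union>i. {y \<in> topspace X. (T ^^ i) y \<in> M})"
      using hits[OF per[OF y(2)]] by simp
  qed
  moreover have "closedin X {y \<in> topspace X. (T ^^ i) y \<in> M}" for i
    using M closedin_continuous_map_preimage
      homeomorphic_imp_continuous_map[OF homeomorphic_map_funpow[OF homeo]] by blast
  ultimately have "\<exists>i W3. openin X W3 \<and> W3 \<noteq> {} \<and> W3 \<subseteq> W2 \<and> W3 \<subseteq> {y \<in> topspace X. (T ^^ i) y \<in> M}"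
    by (intro Baire_open) auto
  then obtain i W3 where W3: "openin X W3" "W3 \<noteq> {}" "W3 \<subseteq> W2"
      "W3 \<subseteq> {y \<in> topspace X. (T ^^ i) y \<in> M}"
    by blast
  have hi: "homeomorphic_map X X (T ^^ i)"
    using homeo by (rule homeomorphic_map_funpow)
  have inj: "inj_on (T ^^ i) (topspace X)"
    using hi homeomorphic_imp_injective_map by blast
  have W3X: "W3 \<subseteq> topspace X"
    using W3(1) openin_subset by blast
  have "openin X ((T ^^ i) ` W3)"
    using W3(1) W3X homeomorphic_map_openness[OF hi] by blast
  then obtain C where C: "clopenin X C" "C \<noteq> {}" "C \<subseteq> (T ^^ i) ` W3"
    using W3(2) clopen_nbhd by (metis all_not_in_conv image_is_empty)
  show False
  proof (rule no_perfect_periodic_tower[OF C(1,2) _ k])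
    fix z assume "z \<in> C"
    then obtain w where w: "w \<in> W3" "z = (T ^^ i) w"
      using C(3) by blast
    then have "w \<in> V" "w \<in> topspace X"
      using W3 W(3) W3X unfolding W2_def by blast+
    then show "\<not> openin X {z}"
      using perfect homeomorphic_map_openness[OF hi, of "{w}"] w by auto
    have "w \<in> W"
      using w W3(3) unfolding W2_def by blast
    then show "(T ^^ k) z = z"
      using W(4) w(2) funpow_swap[of k T i w] by simp
    fix j assume j: "0 < j" "j < k"
    show "(T ^^ j) z \<notin> C"
    proof
      assume "(T ^^ j) z \<in> C"
      then obtain w' where w': "w' \<in> W3" "(T ^^ j) z = (T ^^ i) w'"
        using C(3) by blast
      then have "(T ^^ i) ((T ^^ j) w) = (T ^^ i) w'"
        using w(2) funpow_swap[of i T j w] by simp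
      then have "(T ^^ j) w = w'"
        using inj W3X w(1) w'(1) funpow_in by (meson inj_onD subsetD)
      moreover have "w \<in> W2" "w' \<in> W2"
        using w(1) w'(1) W3(3) by blast+
      moreover have "j \<in> {0<..<k}"
        using j by simp
      ultimately have "(T ^^ j) w \<notin> E j" "w' \<in> E j"
        unfolding W2_def by blast+
      then show False
        using \<open>(T ^^ j) w = w'\<close> by simp
    qed
  next
    fix g assume "homeomorphic_map X X g" "\<And>x. x \<in> topspace X \<Longrightarrow> x \<notin> C \<Longrightarrow> g x = x"
    moreover have "C \<subseteq> M"
      using C(3) W3(4) by blast
    ultimately show "topologically_conjugate X (T \<circ> g) X T"
      by (intro conj) (auto dest: subsetD)
  qed
qed

end

section \<open>Decreasing markers\<close>

context zsystem
begin

text \<open>The bound \<open>K\<close> is uniform over all points; this also gives visits in the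
  past, by starting \<open>K\<close> steps back. With \<open>0 < i\<close> a visit counts as a
  return.\<close>

definition marker :: "'a set \<Rightarrow> bool" where
  "marker Y \<longleftrightarrow> clopenin X Y \<and> (\<exists>K. \<forall>x\<in>topspace X. \<exists>i. 0 < i \<and> i \<le> K \<and> (T ^^ i) x \<in> Y)"

lemma marker_topspace: "marker (topspace X)"
  unfolding marker_def
  by (metis T_in clopenin_topspace funpow_0 funpow_simps_right(1) funpow.simps(2) id_apply le_refl o_apply zero_less_one One_nat_def)

lemma shrink_marker:
  assumes Y: "marker Y" and x: "x \<in> Y" "x \<in> U" and i: "(T ^^ i) x \<in> Y" "(T ^^ i) x \<noteq> x"
  shows "\<exists>Y'. marker Y' \<and> Y' \<subseteq> Y \<and> \<not> U \<subseteq> Y'"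
proof -
  obtain K where Y': "clopenin X Y" and K: "\<And>x. x \<in> topspace X \<Longrightarrow> \<exists>i. 0 < i \<and> i \<le> K \<and> (T ^^ i) x \<in> Y"
    using Y unfolding marker_def by blast
  have YX: "Y \<subseteq> topspace X"
    using Y' by (rule clopenin_subset)
  then have "x \<in> topspace X" "(T ^^ i) x \<in> topspace X"
    using x(1) by auto
  then obtain D where D: "clopenin X D" "x \<in> D" "(T ^^ i) x \<notin> D"
    using i(2)[symmetric] by (rule clopen_separation)
  \<comment> \<open>Points of \<open>D\<close> that \<open>T ^^ i\<close> sends into
    \<open>Y\<close> but out of \<open>D\<close>. An orbit entering \<open>W\<close> is caught
    \<open>i\<close> steps later in \<open>Y - D\<close>, so after deleting \<open>W\<close> the
    bound only grows from \<open>K\<close> to \<open>K + i\<close>.\<close>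
  define W where "W = D \<inter> {y \<in> topspace X. (T ^^ i) y \<in> Y - D}"
  have "clopenin X W"
    unfolding W_def using D(1) Y' homeomorphic_imp_continuous_map[OF homeomorphic_map_funpow[OF homeo]]
    by (intro clopenin_Int clopenin_vimage[where Y = X] clopenin_Diff) auto
  then have "clopenin X (Y - W)"
    using Y' clopenin_Diff by blast
  moreover have "\<exists>j. 0 < j \<and> j \<le> K + i \<and> (T ^^ j) z \<in> Y - W" if z: "z \<in> topspace X" for z
  proof -
    obtain j where j: "0 < j" "j \<le> K" "(T ^^ j) z \<in> Y"
      using K[OF z] by blast
    show ?thesis
    proof (cases "(T ^^ j) z \<in> W")
      case True
      then have "(T ^^ (i + j)) z \<in> Y - W"
        unfolding W_def funpow_add by auto
      then show ?thesis
        using j by (intro exI[of _ "i + j"]) auto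
    next
      case False
      then show ?thesis
        using j by (intro exI[of _ j]) auto
    qed
  qed
  ultimately have "marker (Y - W)"
    unfolding marker_def by blast
  moreover have "x \<in> W"
    unfolding W_def using D x i YX by blast
  ultimately show ?thesis
    using x(2) by (intro exI[of _ "Y - W"]) blast
qed

text \<open>Stage \<open>n\<close> treats \<open>clopens n\<close>: if one of its points in
  \<open>Y n\<close> returns to \<open>Y n\<close> at a different point, the next marker is made to
  miss part of the set; otherwise the marker is kept. A set still contained in
  \<open>Y (Suc n)\<close> thus has only returns at the same point.\<close>

lemma greedy_markers:
  obtains Y where "Y 0 = topspace X" "\<And>n. marker (Y n)" "\<And>n. Y (Suc n) \<subseteq> Y n"
    "\<And>n x i. clopens n \<subseteq> Y (Suc n) \<Longrightarrow> x \<in> clopens n \<Longrightarrow> (T ^^ i) x \<in> Y n \<Longrightarrow> (T ^^ i) x = x"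
proof -
  have "\<exists>Y. \<forall>n. (marker (Y n) \<and> (n = 0 \<longrightarrow> Y n = topspace X)) \<and> (Y (Suc n) \<subseteq> Y n \<and>
      (clopens n \<subseteq> Y (Suc n) \<longrightarrow> (\<forall>x\<in>clopens n. \<forall>i. (T ^^ i) x \<in> Y n \<longrightarrow> (T ^^ i) x = x)))"
  proof (rule dependent_nat_choice)
    show "\<exists>Y. marker Y \<and> ((0::nat) = 0 \<longrightarrow> Y = topspace X)"
      using marker_topspace by blast
    fix Y and n :: nat assume "marker Y \<and> (n = 0 \<longrightarrow> Y = topspace X)"
    then have Y: "marker Y" ..
    show "\<exists>Y'. (marker Y' \<and> (Suc n = 0 \<longrightarrow> Y' = topspace X)) \<and> Y' \<subseteq> Y \<and>
        (clopens n \<subseteq> Y' \<longrightarrow> (\<forall>x\<in>clopens n. \<forall>i. (T ^^ i) x \<in> Y \<longrightarrow> (T ^^ i) x = x))"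
    proof (cases "\<exists>x i. x \<in> Y \<and> x \<in> clopens n \<and> (T ^^ i) x \<in> Y \<and> (T ^^ i) x \<noteq> x")
      case True
      then obtain x i where "x \<in> Y" "x \<in> clopens n" "(T ^^ i) x \<in> Y" "(T ^^ i) x \<noteq> x"
        by blast
      then obtain Y' where "marker Y'" "Y' \<subseteq> Y" "\<not> clopens n \<subseteq> Y'"
        using shrink_marker[OF Y] by meson
      then show ?thesis
        by (intro exI[of _ Y']) simp
    next
      case False
      then show ?thesis
        using Y by (intro exI[of _ Y]) auto
    qed
  qed
  then obtain Y where *: "\<forall>n. (marker (Y n) \<and> (n = 0 \<longrightarrow> Y n = topspace X)) \<and> (Y (Suc n) \<subseteq> Y n \<and>
      (clopens n \<subseteq> Y (Suc n) \<longrightarrow> (\<forall>x\<in>clopens n. \<forall>i. (T ^^ i) x \<in> Y n \<longrightarrow> (T ^^ i) x = x)))" ..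
  note Y = *[rule_format, THEN conjunct1] and Y' = *[rule_format, THEN conjunct2]
  show ?thesis
  proof (rule that[of Y])
    show "Y 0 = topspace X"
      using Y[of 0] by simp
    show "marker (Y n)" for n
      using Y[of n] by (rule conjunct1)
    show "Y (Suc n) \<subseteq> Y n" for n
      using Y'[of n] by (rule conjunct1)
    show "(T ^^ i) x = x"
      if "clopens n \<subseteq> Y (Suc n)" "x \<in> clopens n" "(T ^^ i) x \<in> Y n" for n x i
      using Y'[of n] that by blast
  qed
qed

text \<open>Each clopen subset of \<open>V\<close> has survived its own stage, so its points return
  to that marker only at themselves and are periodic; \<open>dense\<close> finds an isolated one.
  Separating \<open>x\<close> from \<open>y\<close> would give two such points in \<open>V\<close>,
  on one orbit by \<open>iso\<close>, hence equal.\<close>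

lemma greedy_markers_interior:
  assumes iso: "\<And>x y. openin X {x} \<Longrightarrow> periodic x \<Longrightarrow> openin X {y} \<Longrightarrow> periodic y \<Longrightarrow> y \<in> orbit x"
    and dense: "\<And>V. openin X V \<Longrightarrow> V \<noteq> {} \<Longrightarrow> \<exists>x\<in>V. openin X {x} \<or> \<not> periodic x"
    and Y: "\<And>n. marker (Y n)"
      "\<And>n x i. clopens n \<subseteq> Y (Suc n) \<Longrightarrow> x \<in> clopens n \<Longrightarrow> (T ^^ i) x \<in> Y n \<Longrightarrow> (T ^^ i) x = x"
    and V: "openin X V" "V \<subseteq> (\<Inter>n. Y n)" "x \<in> V" "y \<in> V"
  shows "x = y"
proof (rule ccontr)
  assume "x \<noteq> y"
  have VX: "V \<subseteq> topspace X"
    using V(1) openin_subset by blast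
  then have "x \<in> topspace X" "y \<in> topspace X"
    using V by auto
  then obtain D where D: "clopenin X D" "x \<in> D" "y \<notin> D"
    using \<open>x \<noteq> y\<close> by (rule clopen_separation)
  have "openin X (V \<inter> D)" "openin X (V - D)"
    using V(1) D(1) unfolding clopenin_def by blast+
  moreover have "x \<in> V \<inter> D" "y \<in> V - D"
    using V D by auto
  ultimately obtain A B where A: "clopenin X A" "x \<in> A" "A \<subseteq> V \<inter> D"
      and B: "clopenin X B" "y \<in> B" "B \<subseteq> V - D"
    using clopen_nbhd by metis
  have isolated: "\<exists>z\<in>C. openin X {z} \<and> periodic z \<and> (\<forall>i. (T ^^ i) z \<in> V \<longrightarrow> (T ^^ i) z = z)"
    if C: "clopenin X C" "C \<subseteq> V" "C \<noteq> {}" for C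
  proof -
    obtain n where n: "C = clopens n"
      using C(1) by (rule clopensE)
    have ret: "(T ^^ i) z = z" if "z \<in> C" "(T ^^ i) z \<in> Y n" for z i
      using Y(2)[of n z i] that C(2) V(2) unfolding n by blast
    have "periodic z" if z: "z \<in> C" for z
    proof -
      have zX: "z \<in> topspace X"
        using z C VX by blast
      then obtain i where "0 < i" "(T ^^ i) z \<in> Y n"
        using Y(1)[of n] unfolding marker_def by blast
      then show ?thesis
        using ret[OF z] zX unfolding periodic_def by blast
    qed
    moreover obtain z where "z \<in> C" "openin X {z} \<or> \<not> periodic z"
      using dense[OF clopenin_openin[OF C(1)] C(3)] by blast
    ultimately show ?thesis
      using ret V(2) by blast
  qed
  obtain a where a: "a \<in> A" "openin X {a}" "periodic a" "\<And>i. (T ^^ i) a \<in> V \<Longrightarrow> (T ^^ i) a = a"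
    using isolated[OF A(1)] A by blast
  obtain b where b: "b \<in> B" "openin X {b}" "periodic b"
    using isolated[OF B(1)] B by blast
  have "b \<in> orbit a"
    using iso a b by blast
  then have "b = a"
    using a(4) b(1) B(3) unfolding orbit_def by blast
  then show False
    using a(1) b(1) A(3) B(3) by blast
qed

end

section \<open>Locally constant functions\<close>

context zspace
begin

definition locally_constant :: "('a \<Rightarrow> 'b) \<Rightarrow> bool" where
  "locally_constant f \<longleftrightarrow> (\<forall>a. openin X {x \<in> topspace X. f x = a})"

lemma locally_constant_open: "locally_constant f \<Longrightarrow> openin X {x \<in> topspace X. P (f x)}"
proof -
  assume "locally_constant f"
  then have "openin X (\<Union>a\<in>Collect P. {x \<in> topspace X. f x = a})"
    unfolding locally_constant_def by blast
  moreover have "(\<Union>a\<in>Collect P. {x \<in> topspace X. f x = a}) = {x \<in> topspace X. P (f x)}"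
    by blast
  ultimately show ?thesis
    by simp
qed

lemma locally_constant_clopen:
  assumes "locally_constant f"
  shows "clopenin X {x \<in> topspace X. P (f x)}"
proof -
  have "topspace X - {x \<in> topspace X. P (f x)} = {x \<in> topspace X. \<not> P (f x)}"
    by blast
  then show ?thesis
    using locally_constant_open[OF assms, of P] locally_constant_open[OF assms, of "\<lambda>a. \<not> P a"]
    by (auto simp: clopenin_def closedin_def)
qed

lemma locally_constant_const: "locally_constant (\<lambda>_. c)"
proof -
  have "{x \<in> topspace X. c = a} = (if c = a then topspace X else {})" for a
    by auto
  then show ?thesis
    unfolding locally_constant_def by simp
qed

text \<open>Lets the number of iterations of a map vary locally constantly with the point, as in
  \<open>base\<close>.\<close>

lemma locally_constant_index:
  assumes "locally_constant k" "\<And>i. locally_constant (g i)"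
  shows "locally_constant (\<lambda>x. g (k x) x)"
proof -
  have "openin X (\<Union>i. {x \<in> topspace X. k x = i} \<inter> {x \<in> topspace X. g i x = a})" for a
    using assms unfolding locally_constant_def by (intro openin_Union ballI) auto
  moreover have "(\<Union>i. {x \<in> topspace X. k x = i} \<inter> {x \<in> topspace X. g i x = a})
      = {x \<in> topspace X. g (k x) x = a}" for a
    by blast
  ultimately show ?thesis
    unfolding locally_constant_def by simp
qed

lemma locally_constant_comp:
  assumes "locally_constant f"
  shows "locally_constant (\<lambda>x. h (f x))"
  unfolding locally_constant_def
proof
  fix a
  show "openin X {x \<in> topspace X. h (f x) = a}"
    using locally_constant_open[OF assms, of "\<lambda>b. h b = a"] .
qed

lemma locally_constant_comp2:
  assumes "locally_constant f" "locally_constant g"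
  shows "locally_constant (\<lambda>x. h (f x) (g x))"
  using locally_constant_index[OF assms(1), of "\<lambda>a x. h a (g x)"] locally_constant_comp[OF assms(2)]
  by blast

lemma locally_constant_member: "clopenin X C \<Longrightarrow> locally_constant (\<lambda>x. x \<in> C)"
proof -
  assume C: "clopenin X C"
  have "openin X C" "openin X (topspace X - C)"
    using C by (auto simp: clopenin_def)
  moreover have "{x \<in> topspace X. (x \<in> C) = b} = (if b then C else topspace X - C)" for b
    using clopenin_subset[OF C] by auto
  ultimately show ?thesis
    unfolding locally_constant_def by simp
qed

lemma locally_constant_shift:
  assumes "locally_constant f" "continuous_map X X t"
  shows "locally_constant (\<lambda>x. f (t x))"
  unfolding locally_constant_def
proof
  fix a
  have "openin X {x \<in> topspace X. t x \<in> {y \<in> topspace X. f y = a}}"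
    using assms unfolding locally_constant_def by (blast intro: openin_continuous_map_preimage)
  moreover have "{x \<in> topspace X. t x \<in> {y \<in> topspace X. f y = a}} = {x \<in> topspace X. f (t x) = a}"
    using continuous_map_funspace[OF assms(2)] by auto
  ultimately show "openin X {x \<in> topspace X. f (t x) = a}"
    by simp
qed

lemma locally_constant_map:
  assumes "\<And>i. locally_constant (f i)"
  shows "locally_constant (\<lambda>x. map (\<lambda>i. f i x) [0..<n])"
proof (induction n)
  case (Suc n)
  then show ?case
    using locally_constant_comp2[OF Suc.IH assms[of n], of "\<lambda>xs a. xs @ [a]"] by simp
qed (simp add: locally_constant_const)

text \<open>Whether the least index equals \<open>a\<close> depends only on the finitely many
  conditions \<open>P 0\<close>, ..., \<open>P a\<close>.\<close>

lemma locally_constant_Least: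
  assumes "\<And>i. locally_constant (P i)" "\<And>x. x \<in> topspace X \<Longrightarrow> \<exists>i. P i x"
  shows "locally_constant (\<lambda>x. LEAST i::nat. P i x)"
  unfolding locally_constant_def
proof
  fix a
  have "openin X ({x \<in> topspace X. P a x} \<inter> {x \<in> topspace X. \<forall>i\<in>{..<a}. \<not> P i x})"
    using locally_constant_open[OF assms(1), of "\<lambda>b. b"] locally_constant_open[OF assms(1), of Not]
    by (intro openin_Int openin_Collect_finite_ball) auto
  moreover have "{x \<in> topspace X. P a x} \<inter> {x \<in> topspace X. \<forall>i\<in>{..<a}. \<not> P i x}
      = {x \<in> topspace X. (LEAST i. P i x) = a}"
  proof (rule set_eqI)
    fix x
    have "(LEAST i. P i x) = a \<longleftrightarrow> P a x \<and> (\<forall>i<a. \<not> P i x)" if x: "x \<in> topspace X"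
    proof
      assume "(LEAST i. P i x) = a"
      then show "P a x \<and> (\<forall>i<a. \<not> P i x)"
        using LeastI_ex[OF assms(2)[OF x]] not_less_Least by blast
    next
      assume "P a x \<and> (\<forall>i<a. \<not> P i x)"
      then show "(LEAST i. P i x) = a"
        by (intro Least_equality) (auto intro: leI)
    qed
    then show "x \<in> {x \<in> topspace X. P a x} \<inter> {x \<in> topspace X. \<forall>i\<in>{..<a}. \<not> P i x}
        \<longleftrightarrow> x \<in> {x \<in> topspace X. (LEAST i. P i x) = a}"
      by blast
  qed
  ultimately show "openin X {x \<in> topspace X. (LEAST i. P i x) = a}"
    by simp
qed

lemma locally_constant_finite_range:
  assumes "locally_constant f"
  shows "finite (f ` topspace X)"
proof -
  define \<U> where "\<U> = range (\<lambda>a. {x \<in> topspace X. f x = a})"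
  have "openin X U" if "U \<in> \<U>" for U
    using assms that unfolding locally_constant_def \<U>_def by (elim rangeE) simp
  moreover have "topspace X \<subseteq> \<Union>\<U>"
    unfolding \<U>_def by blast
  ultimately have "\<exists>\<F>. finite \<F> \<and> \<F> \<subseteq> \<U> \<and> topspace X \<subseteq> \<Union>\<F>"
    using compact unfolding compact_space_alt by simp
  then obtain \<F> where F: "finite \<F>" "\<F> \<subseteq> \<U>" "topspace X \<subseteq> \<Union>\<F>"
    by blast
  obtain A where "finite A" "\<F> = (\<lambda>a. {x \<in> topspace X. f x = a}) ` A"
    using finite_subset_image[OF F(1) F(2)[unfolded \<U>_def]] by blast
  then have "f ` topspace X \<subseteq> A"
    using F(3) by blast
  then show ?thesis
    using \<open>finite A\<close> finite_subset by blast
qed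

end

section \<open>The Bratteli diagram of a sequence of markers\<close>

text \<open>\<open>T\<close> is a bijection of the whole type here, so that \<open>inv T\<close> is
  a two-sided inverse everywhere; the theorem arranges this by extending the map with the identity
  off the space.\<close>

locale marked_system = zsystem X T for X :: "'a topology" and T :: "'a \<Rightarrow> 'a" +
  fixes Y :: "nat \<Rightarrow> 'a set"
  assumes bij: "bij T" and nonempty: "topspace X \<noteq> {}"
    and Y_0: "Y 0 = topspace X" and Y_marker: "\<And>n. marker (Y n)" and Y_Suc: "\<And>n. Y (Suc n) \<subseteq> Y n"
begin

abbreviation T' :: "'a \<Rightarrow> 'a" where
  "T' \<equiv> inv T"

lemma T'_T: "T' (T x) = x"
  using bij by (simp add: bij_is_inj)

lemma funpow_T_T': "(T ^^ i) ((T' ^^ i) x) = x"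
  using fun_cong[OF fn_o_inv_fn_is_id[OF bij, of i], of x] by simp

lemma funpow_T'_T: "(T' ^^ i) ((T ^^ i) x) = x"
  using fun_cong[OF inv_fn_o_fn_is_id[OF bij, of i], of x] by simp

lemma funpow_split: "i \<le> j \<Longrightarrow> (f ^^ j) x = (f ^^ i) ((f ^^ (j - i)) x)"
  by (metis funpow_add le_add_diff_inverse o_apply)

lemma funpow_T'_T_diff: "i \<le> j \<Longrightarrow> (T' ^^ i) ((T ^^ j) x) = (T ^^ (j - i)) x"
  using funpow_split[of i j T x] funpow_T'_T by simp

lemma funpow_T_T'_diff: "i \<le> j \<Longrightarrow> (T ^^ i) ((T' ^^ j) x) = (T' ^^ (j - i)) x"
  using funpow_split[of i j T' x] funpow_T_T' by simp

lemma homeo_T': "homeomorphic_map X X T'"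
proof -
  obtain S where S: "homeomorphic_maps X X T S"
    using homeo homeomorphic_map_maps by blast
  then have "T' x = S x" if "x \<in> topspace X" for x
    using that T'_T unfolding homeomorphic_maps_def by metis
  moreover have "homeomorphic_map X X S"
    using S homeomorphic_maps_map by blast
  ultimately show ?thesis
    using homeomorphic_map_eq by (metis (full_types))
qed

lemma funpow_T'_in: "x \<in> topspace X \<Longrightarrow> (T' ^^ i) x \<in> topspace X"
  using homeomorphic_map_funpow[OF homeo_T'] homeomorphic_imp_surjective_map by blast

lemma clopenin_Y: "clopenin X (Y n)"
  using Y_marker unfolding marker_def by blast

lemma Y_in: "y \<in> Y n \<Longrightarrow> y \<in> topspace X"
  using clopenin_subset[OF clopenin_Y] by blast

lemma Y_antimono: "m \<le> n \<Longrightarrow> Y n \<subseteq> Y m"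
  using Y_Suc by (rule lift_Suc_antimono_le)

text \<open>The tower picture: \<open>x\<close> stands at height \<open>age n x\<close> in the
  column over its last marker visit \<open>base n x\<close>, and that column has height
  \<open>ret n (base n x)\<close>. The search starts at 1 for \<open>ret\<close> and at 0 for
  \<open>age\<close>, so marker points have age 0.\<close>

definition ret :: "nat \<Rightarrow> 'a \<Rightarrow> nat" where
  "ret n y = (LEAST i. 0 < i \<and> (T ^^ i) y \<in> Y n)"

definition age :: "nat \<Rightarrow> 'a \<Rightarrow> nat" where
  "age n x = (LEAST i. (T' ^^ i) x \<in> Y n)"

definition base :: "nat \<Rightarrow> 'a \<Rightarrow> 'a" where
  "base n x = (T' ^^ age n x) x"

lemma ret_exists: "x \<in> topspace X \<Longrightarrow> \<exists>i. 0 < i \<and> (T ^^ i) x \<in> Y n"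
  using Y_marker unfolding marker_def by blast

lemma ret:
  assumes "x \<in> topspace X"
  shows "0 < ret n x" "(T ^^ ret n x) x \<in> Y n"
  using LeastI_ex[OF ret_exists[OF assms, of n]] unfolding ret_def by auto

lemma ret_le: "0 < i \<Longrightarrow> (T ^^ i) x \<in> Y n \<Longrightarrow> ret n x \<le> i"
  unfolding ret_def by (simp add: Least_le)

lemma age_exists:
  assumes x: "x \<in> topspace X"
  shows "\<exists>i. (T' ^^ i) x \<in> Y n"
proof -
  obtain K where K: "\<And>x. x \<in> topspace X \<Longrightarrow> \<exists>i. 0 < i \<and> i \<le> K \<and> (T ^^ i) x \<in> Y n"
    using Y_marker[of n] unfolding marker_def by blast
  \<comment> \<open>Starting \<open>K\<close> steps back, a visit within \<open>K\<close> steps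
    happens no later than at \<open>x\<close> itself.\<close>
  then obtain i where "i \<le> K" "(T ^^ i) ((T' ^^ K) x) \<in> Y n"
    using funpow_T'_in[OF x] by blast
  then show ?thesis
    using funpow_T_T'_diff by metis
qed

lemma base_in: "x \<in> topspace X \<Longrightarrow> base n x \<in> Y n"
  using LeastI_ex[OF age_exists] unfolding base_def age_def by blast

lemma age_le: "(T' ^^ i) x \<in> Y n \<Longrightarrow> age n x \<le> i"
  unfolding age_def by (rule Least_le)

lemma funpow_age_base: "(T ^^ age n x) (base n x) = x"
  unfolding base_def by (rule funpow_T_T')

text \<open>If \<open>x\<close> were at or above the return height, the return would be a more
  recent visit than \<open>base n x\<close>.\<close>

lemma age_less_ret:
  assumes "x \<in> topspace X"
  shows "age n x < ret n (base n x)"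
proof (rule ccontr)
  assume "\<not> ?thesis"
  then have le: "ret n (base n x) \<le> age n x"
    by simp
  have r: "0 < ret n (base n x)" "(T ^^ ret n (base n x)) (base n x) \<in> Y n"
    using ret[OF Y_in[OF base_in[OF assms]]] by blast+
  then have "(T' ^^ (age n x - ret n (base n x))) x \<in> Y n"
    using funpow_T_T'_diff[OF le, of x] unfolding base_def by simp
  then show False
    using age_le[of "age n x - ret n (base n x)" x n] r(1) le by simp
qed

lemma age_base_funpow:
  assumes y: "y \<in> Y n" and j: "j < ret n y"
  shows "age n ((T ^^ j) y) = j" "base n ((T ^^ j) y) = y"
proof -
  show age: "age n ((T ^^ j) y) = j"
    unfolding age_def
  proof (rule Least_equality)
    show "(T' ^^ j) ((T ^^ j) y) \<in> Y n"
      using y by (simp add: funpow_T'_T)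
    fix i assume i: "(T' ^^ i) ((T ^^ j) y) \<in> Y n"
    show "j \<le> i"
    proof (rule ccontr)
      assume "\<not> j \<le> i"
      then have "(T ^^ (j - i)) y \<in> Y n" "0 < j - i"
        using i funpow_T'_T_diff[of i j y] by auto
      then show False
        using ret_le[of "j - i" y n] j by simp
    qed
  qed
  show "base n ((T ^^ j) y) = y"
    unfolding base_def age by (rule funpow_T'_T)
qed

lemma age_base_self:
  assumes "y \<in> Y n"
  shows "age n y = 0" "base n y = y"
  using age_base_funpow[OF assms, of 0] ret(1)[OF Y_in[OF assms]] by simp_all

lemma age_mono: "x \<in> topspace X \<Longrightarrow> age n x \<le> age (Suc n) x"
  using base_in[of x "Suc n"] Y_Suc[of n] unfolding base_def by (intro age_le) blast

lemma funpow_offset_base: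
  assumes "x \<in> topspace X"
  shows "(T ^^ (age (Suc n) x - age n x)) (base (Suc n) x) = base n x"
  using funpow_T_T'_diff[of "age (Suc n) x - age n x" "age (Suc n) x" x] age_mono[OF assms, of n]
  unfolding base_def by simp

text \<open>Even indices list the clopen sets, which tell points apart; odd indices list the
  markers. The first \<open>2 * n\<close> terms cover the indices below \<open>n\<close> of both
  lists.\<close>

definition clopen_seq :: "nat \<Rightarrow> 'a set" where
  "clopen_seq m = (if even m then clopens (m div 2) else Y (m div 2))"

text \<open>Recording the visits to \<open>Y 0, \<dots>, Y (n - 1)\<close> makes the words of level \<open>n\<close> determine how they
  decompose into words of level \<open>n - 1\<close>.\<close>

definition letter :: "nat \<Rightarrow> 'a \<Rightarrow> bool list" where
  "letter n x = map (\<lambda>m. x \<in> clopen_seq m) [0..<2 * n]"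

definition word :: "nat \<Rightarrow> 'a \<Rightarrow> bool list list" where
  "word n y = map (\<lambda>i. letter n ((T ^^ i) y)) [0..<ret n y]"

lemma letter_eq_iff: "letter n x = letter n y \<longleftrightarrow> (\<forall>m<2 * n. x \<in> clopen_seq m \<longleftrightarrow> y \<in> clopen_seq m)"
  unfolding letter_def by auto

lemma letter_eq_Y: "letter (Suc n) x = letter (Suc n) y \<Longrightarrow> x \<in> Y n \<longleftrightarrow> y \<in> Y n"
  using letter_eq_iff[of "Suc n" x y] by (auto simp: clopen_seq_def dest!: spec[of _ "2 * n + 1"])

lemma letter_eq_clopens: "letter (Suc n) x = letter (Suc n) y \<Longrightarrow> x \<in> clopens n \<longleftrightarrow> y \<in> clopens n"
  using letter_eq_iff[of "Suc n" x y] by (auto simp: clopen_seq_def dest!: spec[of _ "2 * n"])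

lemma word_eq_iff:
  "word n y = word n z \<longleftrightarrow>
     ret n y = ret n z \<and> (\<forall>i<ret n y. letter n ((T ^^ i) y) = letter n ((T ^^ i) z))"
proof -
  have "length (word n x) = ret n x" for x
    unfolding word_def by simp
  moreover have "word n x ! i = letter n ((T ^^ i) x)" if "i < ret n x" for x i
    using that unfolding word_def by simp
  ultimately show ?thesis
    by (auto simp: list_eq_iff_nth_eq)
qed

text \<open>Letters of level \<open>Suc n\<close> show the visits to \<open>Y n\<close>, so
  \<open>y\<close> and \<open>z\<close> visit it at the same times below the return time; at the
  return time both are in \<open>Y (Suc n)\<close>, hence in \<open>Y n\<close>. So the columns of
  level \<open>n\<close> inside theirs have equal heights and letters.\<close>

lemma word_refines:
  assumes y: "y \<in> Y (Suc n)" and z: "z \<in> Y (Suc n)" and w: "word (Suc n) y = word (Suc n) z"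
    and i: "i < ret (Suc n) y" "(T ^^ i) y \<in> Y n"
  shows "(T ^^ i) z \<in> Y n" "word n ((T ^^ i) y) = word n ((T ^^ i) z)"
    "i + ret n ((T ^^ i) y) \<le> ret (Suc n) y"
proof -
  have ret_eq: "ret (Suc n) y = ret (Suc n) z"
    and let_eq: "\<And>j. j < ret (Suc n) y \<Longrightarrow> letter (Suc n) ((T ^^ j) y) = letter (Suc n) ((T ^^ j) z)"
    using w unfolding word_eq_iff by blast+
  show iz: "(T ^^ i) z \<in> Y n"
    using letter_eq_Y[OF let_eq[OF i(1)]] i(2) by simp
  have last: "i + ret n ((T ^^ i) x) \<le> ret (Suc n) x" if "x \<in> Y (Suc n)" "i < ret (Suc n) x" for x
  proof -
    have "(T ^^ (ret (Suc n) x - i)) ((T ^^ i) x) = (T ^^ ret (Suc n) x) x"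
      using that(2) by (metis funpow_add le_add_diff_inverse2 less_imp_le_nat o_apply)
    then have "(T ^^ (ret (Suc n) x - i)) ((T ^^ i) x) \<in> Y n"
      using ret(2)[OF Y_in[OF that(1)], of "Suc n"] Y_Suc by auto
    then show ?thesis
      using ret_le[of "ret (Suc n) x - i" "(T ^^ i) x" n] that(2) by simp
  qed
  show "i + ret n ((T ^^ i) y) \<le> ret (Suc n) y"
    using last[OF y i(1)] .
  have visit: "(T ^^ j) ((T ^^ i) y) \<in> Y n \<longleftrightarrow> (T ^^ j) ((T ^^ i) z) \<in> Y n" if "i + j \<le> ret (Suc n) y" for j
  proof (cases "i + j = ret (Suc n) y")
    case True
    then have "(T ^^ j) ((T ^^ i) y) \<in> Y (Suc n)" "(T ^^ j) ((T ^^ i) z) \<in> Y (Suc n)"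
      using ret(2)[OF Y_in[OF y], of "Suc n"] ret(2)[OF Y_in[OF z], of "Suc n"] ret_eq
      by (metis add.commute funpow_add o_apply)+
    then show ?thesis
      using Y_Suc by blast
  next
    case False
    then show ?thesis
      using letter_eq_Y[OF let_eq[of "j + i"]] that by (simp add: funpow_add)
  qed
  have iyX: "(T ^^ i) y \<in> topspace X" and izX: "(T ^^ i) z \<in> topspace X"
    using Y_in y z by auto
  have "ret n ((T ^^ i) y) = ret n ((T ^^ i) z)"
  proof (rule antisym)
    have "(T ^^ ret n ((T ^^ i) z)) ((T ^^ i) y) \<in> Y n"
      using visit[of "ret n ((T ^^ i) z)"] last[OF z] i(1) ret_eq ret(2)[OF izX, of n] by simp
    then show "ret n ((T ^^ i) y) \<le> ret n ((T ^^ i) z)"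
      using ret(1)[OF izX] by (intro ret_le)
    have "(T ^^ ret n ((T ^^ i) y)) ((T ^^ i) z) \<in> Y n"
      using visit[of "ret n ((T ^^ i) y)"] last[OF y] i(1) ret(2)[OF iyX, of n] by simp
    then show "ret n ((T ^^ i) z) \<le> ret n ((T ^^ i) y)"
      using ret(1)[OF iyX] by (intro ret_le)
  qed
  moreover have "letter n ((T ^^ j) ((T ^^ i) y)) = letter n ((T ^^ j) ((T ^^ i) z))"
    if "j < ret n ((T ^^ i) y)" for j
  proof -
    have "letter (Suc n) ((T ^^ (j + i)) y) = letter (Suc n) ((T ^^ (j + i)) z)"
      using that last[OF y i(1)] by (intro let_eq) simp
    then show ?thesis
      unfolding letter_eq_iff funpow_add by simp
  qed
  ultimately show "word n ((T ^^ i) y) = word n ((T ^^ i) z)"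
    unfolding word_eq_iff by blast
qed

lemma letter_eq_if_word_eq:
  assumes "x \<in> topspace X" "z \<in> topspace X"
    and "word n (base n x) = word n (base n z)" "age n x = age n z"
  shows "letter n x = letter n z"
  using assms(3,4) age_less_ret[OF assms(1), of n] funpow_age_base unfolding word_eq_iff by metis

lemma continuous_funpow: "continuous_map X X (T ^^ i)" "continuous_map X X (T' ^^ i)"
  using homeomorphic_map_funpow homeo homeo_T' homeomorphic_imp_continuous_map by blast+

lemma locally_constant_ret: "locally_constant (ret n)"
proof -
  have "locally_constant (\<lambda>y. 0 < i \<and> (T ^^ i) y \<in> Y n)" for i
    using locally_constant_shift[OF locally_constant_member[OF clopenin_Y] continuous_funpow(1)]
    by (rule locally_constant_comp)
  then show ?thesis
    unfolding ret_def[abs_def] using ret_exists by (rule locally_constant_Least)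
qed

lemma locally_constant_age: "locally_constant (age n)"
  unfolding age_def[abs_def]
  by (intro locally_constant_Least age_exists
      locally_constant_shift[OF locally_constant_member[OF clopenin_Y] continuous_funpow(2)])

lemma locally_constant_letter: "locally_constant (letter n)"
  unfolding letter_def[abs_def]
  by (intro locally_constant_map locally_constant_member)
    (simp add: clopen_seq_def clopenin_clopens clopenin_Y)

lemma locally_constant_word: "locally_constant (word n)"
  unfolding word_def[abs_def]
  by (intro locally_constant_index[of "ret n" "\<lambda>k y. map (\<lambda>i. letter n ((T ^^ i) y)) [0..<k]"]
      locally_constant_ret locally_constant_map
      locally_constant_shift[OF locally_constant_letter continuous_funpow(1)])

lemma locally_constant_word_base: "locally_constant (\<lambda>x. word n (base n x))"
  unfolding base_def
  by (intro locally_constant_index[of "age n" "\<lambda>k x. word n ((T' ^^ k) x)"]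
      locally_constant_age locally_constant_shift[OF locally_constant_word continuous_funpow(2)])

text \<open>A column type. The level is included to keep the levels disjoint, and the coding by
  naturals meets the types in \<open>bratteli_vershikizable\<close>.\<close>

definition vertex :: "nat \<Rightarrow> 'a \<Rightarrow> nat" where
  "vertex n x = to_nat (n, word n (base n x))"

definition offset :: "nat \<Rightarrow> 'a \<Rightarrow> nat" where
  "offset n x = age (Suc n) x - age n x"

text \<open>An occurrence of a column of level \<open>n\<close> inside one of level
  \<open>Suc n\<close>; \<open>offset\<close> is the height at which the smaller column starts, and
  it will define the order.\<close>

definition edge :: "nat \<Rightarrow> 'a \<Rightarrow> nat" where
  "edge n x = to_nat (vertex (Suc n) x, vertex n x, offset n x)"

definition edge_parts :: "nat \<Rightarrow> nat \<times> nat \<times> nat" where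
  "edge_parts = from_nat"

lemma edge_parts_edge: "edge_parts (edge n x) = (vertex (Suc n) x, vertex n x, offset n x)"
  unfolding edge_parts_def edge_def by simp

definition diagram :: "(nat, nat) ordered_bratteli" where
  "diagram = \<lparr>vertex_level = \<lambda>n. vertex n ` topspace X, edge_level = \<lambda>n. edge n ` topspace X,
     source = \<lambda>e. fst (edge_parts e), target = \<lambda>e. fst (snd (edge_parts e)),
     edge_order = {(e, e'). e \<in> (\<Union>n. edge n ` topspace X) \<and> e' \<in> (\<Union>n. edge n ` topspace X) \<and>
       fst (edge_parts e) = fst (edge_parts e') \<and>
       snd (snd (edge_parts e)) < snd (snd (edge_parts e'))}\<rparr>"

lemma diagram_simps [simp]:
  "vertex_level diagram n = vertex n ` topspace X"
  "edge_level diagram n = edge n ` topspace X"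
  "source diagram (edge n x) = vertex (Suc n) x"
  "target diagram (edge n x) = vertex n x"
  unfolding diagram_def by (simp_all add: edge_parts_edge)

lemma edge_order_diagram:
  "(e, e') \<in> edge_order diagram \<longleftrightarrow> e \<in> (\<Union>n. edge n ` topspace X) \<and> e' \<in> (\<Union>n. edge n ` topspace X) \<and>
     source diagram e = source diagram e' \<and> snd (snd (edge_parts e)) < snd (snd (edge_parts e'))"
  unfolding diagram_def by simp

lemma vertex_eq_iff: "vertex n x = vertex m z \<longleftrightarrow> n = m \<and> word n (base n x) = word m (base m z)"
  unfolding vertex_def by auto

lemma edge_eq_iff:
  "edge n x = edge m z \<longleftrightarrow> vertex (Suc n) x = vertex (Suc m) z \<and> vertex n x = vertex m z \<and> offset n x = offset m z"
  unfolding edge_def by simp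

lemma age_Suc: "x \<in> topspace X \<Longrightarrow> age (Suc n) x = age n x + offset n x"
  using age_mono[of x n] unfolding offset_def by simp

lemma offset_less: "x \<in> topspace X \<Longrightarrow> offset n x < ret (Suc n) (base (Suc n) x)"
  using age_less_ret[of x "Suc n"] unfolding offset_def by simp

lemma age_0: "x \<in> topspace X \<Longrightarrow> age 0 x = 0"
  using age_base_self[of x 0] Y_0 by simp

text \<open>A word of level \<open>Suc n\<close> determines which word of level \<open>n\<close>
  starts at a given height. Hence different edges with one source have different offsets, which
  makes their order total.\<close>

lemma target_determined:
  assumes x: "x \<in> topspace X" and z: "z \<in> topspace X"
    and "vertex (Suc n) x = vertex (Suc n) z" "offset n x = offset n z"
  shows "edge n x = edge n z"
proof -
  have "word n ((T ^^ offset n x) (base (Suc n) x)) = word n ((T ^^ offset n x) (base (Suc n) z))"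
  proof (rule word_refines(2)[OF base_in[OF x] base_in[OF z] _ offset_less[OF x]])
    show "(T ^^ offset n x) (base (Suc n) x) \<in> Y n"
      using funpow_offset_base[OF x, of n] base_in[OF x] unfolding offset_def by simp
  qed (use assms(3) vertex_eq_iff in blast)
  then have "word n (base n x) = word n (base n z)"
    using assms(4) funpow_offset_base[OF x, of n] funpow_offset_base[OF z, of n]
    unfolding offset_def by metis
  then show ?thesis
    using assms unfolding edge_eq_iff by (simp add: vertex_eq_iff)
qed

lemma locally_constant_vertex: "locally_constant (vertex n)"
  unfolding vertex_def
  by (rule locally_constant_comp[where h = "\<lambda>w. to_nat (n, w)", OF locally_constant_word_base])

lemma locally_constant_offset: "locally_constant (offset n)"
  unfolding offset_def by (rule locally_constant_comp2[OF locally_constant_age locally_constant_age])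

lemma locally_constant_edge: "locally_constant (edge n)"
proof -
  have "locally_constant (\<lambda>x. (vertex n x, offset n x))"
    by (rule locally_constant_comp2[OF locally_constant_vertex locally_constant_offset])
  then have "locally_constant (\<lambda>x. (vertex (Suc n) x, vertex n x, offset n x))"
    by (rule locally_constant_comp2[OF locally_constant_vertex])
  then show ?thesis
    unfolding edge_def by (rule locally_constant_comp)
qed

lemma ordered_diagram: "ordered_bratteli_diagram diagram"
  unfolding ordered_bratteli_diagram_def
proof (intro conjI)
  have fin: "finite (vertex n ` topspace X)" "finite (edge n ` topspace X)" for n
    using locally_constant_vertex locally_constant_edge locally_constant_finite_range by blast+
  \<comment> \<open>As \<open>Y 0\<close> is the whole space, every return time is 1, and letters of
    level 0 are empty; so all points share one vertex.\<close>
  have "word 0 (base 0 x) = [[]]" if "x \<in> topspace X" for x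
  proof -
    have "base 0 x = x" "ret 0 x = 1"
      using that age_base_self[of x 0] ret(1)[OF that, of 0] ret_le[of 1 x 0] Y_0 by auto
    then show ?thesis
      by (simp add: word_def letter_def)
  qed
  then have "vertex 0 x = to_nat (0 :: nat, [[]] :: bool list list)" if "x \<in> topspace X" for x
    using that unfolding vertex_def by simp
  then have root: "\<exists>v. vertex 0 ` topspace X = {v}"
    using nonempty by (metis image_cong image_constant_conv)
  show "bratteli_diagram diagram"
    unfolding bratteli_diagram_def
  proof (intro conjI allI)
    show "finite (vertex_level diagram k)" "vertex_level diagram k \<noteq> {}" "finite (edge_level diagram k)" for k
      using fin nonempty by auto
    show "disjoint_family (vertex_level diagram)" "disjoint_family (edge_level diagram)"
      unfolding disjoint_family_on_def by (auto simp: vertex_eq_iff edge_eq_iff)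
    show "\<exists>v0. vertex_level diagram 0 = {v0}"
      using root by simp
  qed auto
  show "edge_order diagram \<subseteq> {(e, e'). e \<in> (\<Union>k. edge_level diagram k) \<and>
      e' \<in> (\<Union>k. edge_level diagram k) \<and> source diagram e = source diagram e'}"
    by (auto simp: edge_order_diagram)
  show "\<forall>k. \<forall>v\<in>vertex_level diagram (Suc k).
      strict_linear_order_on {e \<in> edge_level diagram k. source diagram e = v} (edge_order diagram)"
    unfolding strict_linear_order_on_def
  proof (intro allI ballI conjI)
    show "trans (edge_order diagram)"
      by (rule transI) (auto simp: edge_order_diagram)
    show "irrefl (edge_order diagram)"
      by (rule irreflI) (auto simp: edge_order_diagram)
    fix k v
    show "total_on {e \<in> edge_level diagram k. source diagram e = v} (edge_order diagram)"
      unfolding total_on_def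
    proof (intro ballI impI)
      fix e e' assume "e \<in> {e \<in> edge_level diagram k. source diagram e = v}"
        "e' \<in> {e \<in> edge_level diagram k. source diagram e = v}" "e \<noteq> e'"
      then obtain x z where e: "e = edge k x" "e' = edge k z" "x \<in> topspace X" "z \<in> topspace X"
          "vertex (Suc k) x = vertex (Suc k) z" "edge k x \<noteq> edge k z"
        by auto
      then have "offset k x \<noteq> offset k z"
        using target_determined by blast
      then show "(e, e') \<in> edge_order diagram \<or> (e', e) \<in> edge_order diagram"
        using e by (auto simp: edge_order_diagram edge_parts_edge)
    qed
  qed
qed

end

section \<open>The coding map\<close>

context marked_system
begin

definition code :: "'a \<Rightarrow> nat \<Rightarrow> nat" where
  "code x n = edge n x"

lemma code_in: "x \<in> topspace X \<Longrightarrow> code x \<in> topspace (path_space diagram)"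
  by (simp add: topspace_path_space code_def)

text \<open>A descent through the columns: \<open>p n\<close> tells at which height of the column
  over \<open>y\<close> a column of the next lower type begins, and the induction hypothesis
  continues from its base \<open>u\<close>.\<close>

lemma path_prefix:
  assumes p: "p \<in> topspace (path_space diagram)"
    and y: "y \<in> Y n" "\<And>m. n = Suc m \<Longrightarrow> vertex n y = source diagram (p m)"
  shows "\<exists>j<ret n y. \<forall>i<n. edge i ((T ^^ j) y) = p i"
  using y
proof (induction n arbitrary: y)
  case 0
  then show ?case
    using ret(1)[OF Y_in, of y 0 0] by blast
next
  case (Suc n)
  have yX: "y \<in> topspace X"
    using Suc.prems(1) by (rule Y_in)
  have "p n \<in> edge n ` topspace X"
    using p by (simp add: topspace_path_space)
  then obtain x where x: "x \<in> topspace X" "p n = edge n x"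
    by blast
  define u where "u = (T ^^ offset n x) y"
  have base_y: "base (Suc n) y = y"
    using age_base_self(2)[OF Suc.prems(1)] .
  have vert: "vertex (Suc n) y = vertex (Suc n) x"
    using Suc.prems(2)[OF refl] x(2) by simp
  then have w: "word (Suc n) (base (Suc n) x) = word (Suc n) y"
    using base_y by (simp add: vertex_eq_iff)
  have ret_eq: "ret (Suc n) (base (Suc n) x) = ret (Suc n) y"
    using w unfolding word_eq_iff by blast
  have o: "offset n x < ret (Suc n) (base (Suc n) x)" "(T ^^ offset n x) (base (Suc n) x) = base n x"
    using offset_less[OF x(1)] funpow_offset_base[OF x(1)] unfolding offset_def by auto
  have u: "u \<in> Y n" "word n (base n x) = word n u"
    using word_refines(1,2)[OF base_in[OF x(1)] Suc.prems(1) w o(1)] base_in[OF x(1), of n]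
    unfolding o(2) u_def by blast+
  \<comment> \<open>The column over \<open>u\<close> ends within the column over \<open>y\<close>,
    so a height in the former is a valid height in the latter.\<close>
  have inside: "offset n x + ret n u \<le> ret (Suc n) y"
    using word_refines(3)[OF Suc.prems(1) base_in[OF x(1)] w[symmetric]] o(1) u(1)
    unfolding u_def ret_eq by blast
  have base_u: "base n u = u"
    using age_base_self(2)[OF u(1)] .
  have "vertex n u = source diagram (p m)" if "n = Suc m" for m
  proof -
    have "source diagram (p m) = target diagram (p (Suc m))"
      using p by (simp add: topspace_path_space)
    also have "\<dots> = vertex n x"
      using x(2) that by simp
    also have "\<dots> = vertex n u"
      using u(2) base_u by (simp add: vertex_eq_iff)
    finally show ?thesis ..
  qed
  then obtain j where j: "j < ret n u" "\<And>i. i < n \<Longrightarrow> edge i ((T ^^ j) u) = p i"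
    using Suc.IH[OF u(1)] by blast
  have pos: "(T ^^ j) u = (T ^^ (j + offset n x)) y"
    unfolding u_def funpow_add by simp
  have less: "j + offset n x < ret (Suc n) y"
    using j(1) inside by simp
  note at_u = age_base_funpow[OF u(1) j(1)]
  note at_y = age_base_funpow[OF Suc.prems(1) less]
  have "edge n ((T ^^ j) u) = p n"
    using at_u at_y vert u(2) base_y base_u pos x(2)
    unfolding edge_eq_iff by (simp add: edge_eq_iff vertex_eq_iff offset_def)
  then have "\<forall>i<Suc n. edge i ((T ^^ (j + offset n x)) y) = p i"
    using j(2) pos by (simp add: less_Suc_eq)
  then show ?case
    using less by blast
qed

lemma code_surj:
  assumes p: "p \<in> topspace (path_space diagram)"
  shows "p \<in> code ` topspace X"
proof -
  define K where "K n = {x \<in> topspace X. \<forall>i\<in>{..<n}. edge i x = p i}" for n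
  have "K n \<noteq> {}" for n
  proof -
    have "\<exists>y. y \<in> Y n \<and> (\<forall>m. n = Suc m \<longrightarrow> vertex n y = source diagram (p m))"
    proof (cases n)
      case 0
      then show ?thesis
        using nonempty Y_0 by blast
    next
      case (Suc m)
      have "p m \<in> edge m ` topspace X"
        using p by (simp add: topspace_path_space)
      then obtain x where x: "x \<in> topspace X" "p m = edge m x"
        by blast
      have "vertex n (base n x) = source diagram (p m)"
        using x age_base_self(2)[OF base_in[OF x(1)]] Suc by (simp add: vertex_eq_iff)
      then show ?thesis
        using base_in[OF x(1)] Suc by blast
    qed
    then obtain y j where "y \<in> Y n" "\<forall>i<n. edge i ((T ^^ j) y) = p i"
      using path_prefix[OF p] by blast
    then have "(T ^^ j) y \<in> K n"
      using Y_in unfolding K_def by simp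
    then show ?thesis
      by blast
  qed
  moreover have "clopenin X (K n)" for n
  proof (induction n)
    case (Suc n)
    have "K (Suc n) = K n \<inter> {x \<in> topspace X. edge n x = p n}"
      unfolding K_def by (auto simp: less_Suc_eq)
    then show ?case
      using Suc locally_constant_clopen[OF locally_constant_edge, of "\<lambda>e. e = p n" n]
      by (simp add: clopenin_Int)
  qed (simp add: K_def)
  moreover have "K (Suc n) \<subseteq> K n" for n
    unfolding K_def by auto
  ultimately have "(\<Inter>n. K n) \<noteq> {}"
    by (intro clopen_nest)
  then obtain x where x: "\<And>n. x \<in> K n"
    by blast
  have "code x = p"
  proof
    fix n
    show "code x n = p n"
      using x[of "Suc n"] unfolding K_def code_def by simp
  qed
  moreover have "x \<in> topspace X"
    using x[of 0] unfolding K_def by simp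
  ultimately show ?thesis
    by blast
qed

text \<open>Offsets add up to the ages, starting from age 0. Age and column type give the letter at
  every level, and the letters decide membership in every clopen set.\<close>

lemma code_inj: "inj_on code (topspace X)"
proof (rule inj_onI)
  fix x z assume xz: "x \<in> topspace X" "z \<in> topspace X" "code x = code z"
  have e: "edge n x = edge n z" for n
    using fun_cong[OF xz(3), of n] unfolding code_def .
  have age: "age n x = age n z" for n
  proof (induction n)
    case 0
    then show ?case
      using xz age_0 by simp
  next
    case (Suc n)
    then show ?case
      using e[of n] age_Suc xz by (simp add: edge_eq_iff)
  qed
  have "letter n x = letter n z" for n
    using e[of n] age xz by (intro letter_eq_if_word_eq) (auto simp: edge_eq_iff vertex_eq_iff)
  then show "x = z"
    using eq_if_same_clopens letter_eq_clopens xz by blast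
qed

lemma Hausdorff_path_space: "Hausdorff_space (path_space B)"
  unfolding path_space_def by (intro Hausdorff_space_subtopology) (simp add: Hausdorff_space_product_topology)

lemma homeomorphic_map_code: "homeomorphic_map X (path_space diagram) code"
proof (rule continuous_imp_homeomorphic_map)
  have "continuous_map X (discrete_topology (edge_level diagram n)) (\<lambda>x. code x n)" for n
    unfolding continuous_map code_def using locally_constant_open[OF locally_constant_edge] by auto
  then show "continuous_map X (path_space diagram) code"
    unfolding path_space_def using code_in
    by (intro continuous_map_into_subtopology)
      (auto simp: continuous_map_componentwise_UNIV topspace_path_space)
  show "code ` topspace X = topspace (path_space diagram)"
    using code_in code_surj by blast
qed (use compact Hausdorff_path_space code_inj in auto)

text \<open>For paths that agree from \<open>N\<close> on, the order is that of heights in the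
  column of level \<open>N\<close>. At the deciding index \<open>i\<close>, the column of
  \<open>x\<close> has a visit to \<open>Y i\<close> at height \<open>offset i z\<close>, and
  \<open>x\<close> lies below it; further up the same offsets are added to both ages.\<close>

lemma age_less_if_path_less:
  assumes x: "x \<in> topspace X" and z: "z \<in> topspace X" and less: "path_less diagram (code x) (code z)"
    and agree: "\<And>j. N \<le> j \<Longrightarrow> code x j = code z j"
  shows "age N x < age N z"
proof -
  obtain i where i: "\<And>j. i < j \<Longrightarrow> edge j x = edge j z" "(edge i x, edge i z) \<in> edge_order diagram"
    using less unfolding path_less_def code_def by blast
  have v: "vertex (Suc i) x = vertex (Suc i) z" and o: "offset i x < offset i z"
    using i(2) by (auto simp: edge_order_diagram edge_parts_edge)
  have "i < N"
    using o agree[of i] by (auto simp: code_def edge_eq_iff not_le[symmetric])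
  have "word (Suc i) (base (Suc i) z) = word (Suc i) (base (Suc i) x)"
    using v by (simp add: vertex_eq_iff)
  then have visit: "(T ^^ offset i z) (base (Suc i) x) \<in> Y i"
    using word_refines(1)[OF base_in[OF z] base_in[OF x] _ offset_less[OF z]]
      funpow_offset_base[OF z, of i] base_in[OF z, of i] unfolding offset_def by simp
  have "age (Suc i) x < offset i z"
  proof (rule ccontr)
    assume "\<not> ?thesis"
    then have le: "offset i z \<le> age (Suc i) x"
      by simp
    then have "(T' ^^ (age (Suc i) x - offset i z)) x \<in> Y i"
      using visit funpow_T_T'_diff[OF le, of x] unfolding base_def by simp
    then have "age i x \<le> age (Suc i) x - offset i z"
      by (rule age_le)
    then show False
      using o le age_Suc[OF x, of i] by simp
  qed
  also have "\<dots> \<le> age (Suc i) z"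
    unfolding offset_def by simp
  finally have "age (Suc i) x < age (Suc i) z" .
  have "age M x < age M z" if "Suc i \<le> M" for M
    using that
  proof (induction M rule: dec_induct)
    case base
    then show ?case
      using \<open>age (Suc i) x < age (Suc i) z\<close> .
  next
    case (step M)
    then show ?case
      using i(1)[of M] age_Suc[OF x, of M] age_Suc[OF z, of M] by (simp add: edge_eq_iff)
  qed
  then show "age N x < age N z"
    using \<open>i < N\<close> by simp
qed

lemma age_base_T:
  assumes x: "x \<in> topspace X" and "T x \<notin> Y n"
  shows "age n (T x) = Suc (age n x)" "base n (T x) = base n x"
proof -
  have Tx: "T x = (T ^^ Suc (age n x)) (base n x)"
    using funpow_age_base[of n x] by simp
  moreover have "Suc (age n x) \<noteq> ret n (base n x)"
    using assms(2) ret(2)[OF Y_in[OF base_in[OF x]], of n n] Tx by metis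
  ultimately show "age n (T x) = Suc (age n x)" "base n (T x) = base n x"
    using age_base_funpow[OF base_in[OF x], of "Suc (age n x)" n] age_less_ret[OF x, of n] by simp_all
qed

text \<open>Let \<open>n = Suc m\<close> be the first level whose marker \<open>T x\<close> misses.
  From level \<open>n\<close> on, \<open>T\<close> moves up by one in the same column, so later
  edges agree; at level \<open>m\<close> a new column begins, so the offset increases. Nothing fits
  in between, as the ages at level \<open>n\<close> differ by 1.\<close>

lemma code_T_immediate_successor:
  assumes x: "x \<in> topspace X" and "T x \<notin> (\<Inter>n. Y n)"
  shows "immediate_successor diagram (code x) (code (T x))"
proof -
  have Tx: "T x \<in> topspace X"
    using x by simp
  have ex: "\<exists>n. T x \<notin> Y n"
    using assms(2) by blast
  define n where "n = (LEAST n. T x \<notin> Y n)"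
  have n: "T x \<notin> Y n"
    unfolding n_def using LeastI_ex[OF ex] .
  then have "n \<noteq> 0"
    using Y_0 Tx by metis
  then obtain m where m: "n = Suc m"
    using not0_implies_Suc by blast
  have in_m: "T x \<in> Y m"
    using not_less_Least[of m "\<lambda>n. T x \<notin> Y n"] m unfolding n_def by auto
  have off: "T x \<notin> Y k" if "n \<le> k" for k
    using n Y_antimono[OF that] by blast
  note T_step = age_base_T[OF x off]
  have agree: "code x k = code (T x) k" if "m < k" for k
  proof -
    have "n \<le> k" "n \<le> Suc k"
      using that m by auto
    then show ?thesis
      using T_step[of k] T_step[of "Suc k"]
      unfolding code_def edge_eq_iff by (simp add: vertex_eq_iff offset_def)
  qed
  have "vertex (Suc m) x = vertex (Suc m) (T x)"
    using T_step[of n] m by (simp add: vertex_eq_iff)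
  moreover have "offset m x < offset m (T x)"
    using T_step[of n] m age_base_self(1)[OF in_m] unfolding offset_def by simp
  ultimately have "(code x m, code (T x) m) \<in> edge_order diagram"
    using x Tx by (auto simp: edge_order_diagram code_def edge_parts_edge)
  then have less: "path_less diagram (code x) (code (T x))"
    using agree code_in x Tx unfolding path_less_def by blast
  have False if r: "path_less diagram (code x) r" "path_less diagram r (code (T x))" for r
  proof -
    have "r \<in> topspace (path_space diagram)"
      using r(1) unfolding path_less_def by blast
    then obtain z where z: "z \<in> topspace X" "r = code z"
      using code_surj by blast
    have above: "\<And>j. n \<le> j \<Longrightarrow> code z j = code (T x) j" "\<And>j. n \<le> j \<Longrightarrow> code x j = code z j"
      using path_less_between[OF ordered_diagram r, of m] agree m z(2) by auto
    have "age n x < age n z" "age n z < age n (T x)"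
      using age_less_if_path_less[OF x z(1) _ above(2)] age_less_if_path_less[OF z(1) Tx _ above(1)]
        r z(2) by blast+
    then show False
      using T_step[of n] by simp
  qed
  then show ?thesis
    using less unfolding immediate_successor_def by blast
qed

text \<open>If \<open>T x\<close> lies in every marker, \<open>x\<close> is the top of its column at
  each level, and a larger path would need a greater age in a column of the same height.\<close>

lemma maximal_code:
  assumes x: "x \<in> topspace X" and "T x \<in> (\<Inter>n. Y n)"
  shows "maximal_path diagram (code x)"
proof (rule ccontr)
  assume "\<not> ?thesis"
  then obtain r where r: "path_less diagram (code x) r"
    using code_in[OF x] unfolding maximal_path_def by blast
  then have "r \<in> topspace (path_space diagram)"
    unfolding path_less_def by blast
  then obtain z where z: "z \<in> topspace X" "r = code z"
    using code_surj by blast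
  obtain i where i: "\<And>j. i < j \<Longrightarrow> code x j = code z j"
    using r unfolding path_less_def z(2) by blast
  define N where "N = Suc i"
  have agree: "code x j = code z j" if "N \<le> j" for j
    using i that unfolding N_def by simp
  have less: "age N x < age N z"
    using age_less_if_path_less[OF x z(1) _ agree] r z(2) by blast
  have "edge N x = edge N z"
    using agree[of N] unfolding code_def by simp
  then have "ret N (base N x) = ret N (base N z)"
    by (simp add: edge_eq_iff vertex_eq_iff word_eq_iff)
  moreover have "(T ^^ Suc (age N x)) (base N x) \<in> Y N"
    using assms(2) funpow_age_base[of N x] by simp
  then have "ret N (base N x) \<le> Suc (age N x)"
    by (intro ret_le) auto
  ultimately show False
    using less age_less_ret[OF z(1), of N] by simp
qed

lemma maximal_code_iff:
  assumes "x \<in> topspace X"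
  shows "maximal_path diagram (code x) \<longleftrightarrow> T x \<in> (\<Inter>n. Y n)"
  using code_T_immediate_successor[OF assms] maximal_code[OF assms]
  unfolding maximal_path_def immediate_successor_def by blast

lemma homeomorphic_prolongation_code:
  obtains S where "homeomorphic_prolongation diagram S"
    "\<And>x. x \<in> topspace X \<Longrightarrow> code (T x) = S (code x)"
proof -
  let ?P = "path_space diagram"
  obtain d where d: "homeomorphic_maps X ?P code d"
    using homeomorphic_map_code homeomorphic_map_maps by blast
  define S where "S = code \<circ> (T \<circ> d)"
  have "homeomorphic_map ?P X d"
    using d homeomorphic_maps_map by blast
  then have S: "homeomorphic_map ?P ?P S"
    unfolding S_def
    by (intro homeomorphic_map_compose[OF _ homeomorphic_map_code] homeomorphic_map_compose[OF _ homeo])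
  have code_T: "code (T x) = S (code x)" if "x \<in> topspace X" for x
    using d that unfolding S_def homeomorphic_maps_def by simp
  have "S p = vershik_map diagram p" if p: "p \<in> topspace ?P" "\<not> maximal_path diagram p" for p
  proof -
    obtain x where x: "x \<in> topspace X" "p = code x"
      using code_surj[OF p(1)] by blast
    then have "T x \<notin> (\<Inter>n. Y n)"
      using p(2) maximal_code by blast
    then show ?thesis
      using vershik_map_eqI[OF ordered_diagram code_T_immediate_successor[OF x(1)]] code_T x by simp
  qed
  moreover have "S \<in> topspace ?P \<rightarrow> topspace ?P"
    using S homeomorphic_imp_surjective_map by blast
  ultimately have "homeomorphic_prolongation diagram S"
    using S unfolding homeomorphic_prolongation_def vershik_prolongation_def by blast
  then show ?thesis
    using that code_T by blast
qed

lemma prolongation_unique: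
  assumes interior: "\<And>V x y. openin X V \<Longrightarrow> V \<subseteq> (\<Inter>n. Y n) \<Longrightarrow> x \<in> V \<Longrightarrow> y \<in> V \<Longrightarrow> x = y"
    and "homeomorphic_prolongation diagram S" "homeomorphic_prolongation diagram S'"
    and p: "p \<in> topspace (path_space diagram)"
  shows "S p = S' p"
proof -
  let ?P = "path_space diagram"
  have S: "homeomorphic_map ?P ?P S" and S': "homeomorphic_map ?P ?P S'"
    and eq: "\<And>q. q \<in> topspace ?P \<Longrightarrow> \<not> maximal_path diagram q \<Longrightarrow> S q = S' q"
    using assms(2,3) unfolding homeomorphic_prolongation_def vershik_prolongation_def by auto
  define V where "V = {x \<in> topspace X. code x \<in> topspace ?P - {q \<in> topspace ?P. S q = S' q}}"
  have "closedin ?P {q \<in> topspace ?P. S q = S' q}"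
    using closedin_continuous_maps_eq[OF Hausdorff_path_space] S S' homeomorphic_imp_continuous_map
    by blast
  then have V: "openin X V"
    unfolding V_def using homeomorphic_imp_continuous_map[OF homeomorphic_map_code]
    by (intro openin_continuous_map_preimage[where Y = ?P]) auto
  have VX: "V \<subseteq> topspace X"
    unfolding V_def by blast
  have "openin X (T ` V)"
    using V VX homeomorphic_map_openness[OF homeo] by blast
  \<comment> \<open>The prolongations agree at non-maximal paths, so codes of points of
    \<open>V\<close> are maximal.\<close>
  moreover have "T ` V \<subseteq> (\<Inter>n. Y n)"
    using eq maximal_code_iff code_in unfolding V_def by blast
  ultimately have single: "x = z" if "x \<in> V" "z \<in> V" for x z
    using interior[of "T ` V" "T x" "T z"] that bij by (metis bij_is_inj image_eqI injD)
  have others: "S q = S' q" if q: "q \<in> topspace ?P" "q \<noteq> p" and ne: "S p \<noteq> S' p" for q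
  proof (rule ccontr)
    assume "S q \<noteq> S' q"
    obtain x where x: "x \<in> topspace X" "p = code x"
      using code_surj[OF p] by blast
    obtain z where z: "z \<in> topspace X" "q = code z"
      using code_surj[OF q(1)] by blast
    have "x \<in> V" "z \<in> V"
      using \<open>S q \<noteq> S' q\<close> x z q ne p unfolding V_def by auto
    then show False
      using single q(2) x z by blast
  qed
  show "S p = S' p"
  proof (rule ccontr)
    assume ne: "S p \<noteq> S' p"
    \<comment> \<open>\<open>S\<close> takes the value \<open>S' p\<close> at some \<open>q\<close>
      other than \<open>p\<close>; there the maps agree, so \<open>S'\<close> would take it at both
      \<open>p\<close> and \<open>q\<close>.\<close>
    have "S' p \<in> S ` topspace ?P"
      using S S' p homeomorphic_imp_surjective_map by blast
    then obtain q where q: "S' p = S q" "q \<in> topspace ?P"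
      by (rule imageE)
    then have "q \<noteq> p"
      using ne by metis
    then have "S' p = S' q"
      using others[OF q(2) _ ne] q(1) by simp
    then have "p = q"
      by (rule inj_onD[OF homeomorphic_imp_injective_map[OF S'] _ p q(2)])
    then show False
      using \<open>q \<noteq> p\<close> by simp
  qed
qed

lemma decisive_diagram:
  assumes "\<And>V x y. openin X V \<Longrightarrow> V \<subseteq> (\<Inter>n. Y n) \<Longrightarrow> x \<in> V \<Longrightarrow> y \<in> V \<Longrightarrow> x = y"
  shows "decisive diagram"
proof -
  obtain S where "homeomorphic_prolongation diagram S"
    by (rule homeomorphic_prolongation_code)
  moreover have "S p = S' p" if "homeomorphic_prolongation diagram S" "homeomorphic_prolongation diagram S'"
    "p \<in> topspace (path_space diagram)" for S S' p
    using assms that by (rule prolongation_unique)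
  ultimately show ?thesis
    unfolding decisive_def using ordered_diagram by blast
qed

end

section \<open>From the two properties to the theorem\<close>

lemma (in zsystem) vershikizable_if_few_periodic:
  assumes "bij T" "topspace X \<noteq> {}"
    and iso: "\<And>x y. openin X {x} \<Longrightarrow> periodic x \<Longrightarrow> openin X {y} \<Longrightarrow> periodic y \<Longrightarrow> y \<in> orbit x"
    and dense: "\<And>V. openin X V \<Longrightarrow> V \<noteq> {} \<Longrightarrow> \<exists>x\<in>V. openin X {x} \<or> \<not> periodic x"
  shows "bratteli_vershikizable X T"
proof -
  obtain Y where Y: "Y 0 = topspace X" "\<And>n. marker (Y n)" "\<And>n. Y (Suc n) \<subseteq> Y n"
    "\<And>n x i. clopens n \<subseteq> Y (Suc n) \<Longrightarrow> x \<in> clopens n \<Longrightarrow> (T ^^ i) x \<in> Y n \<Longrightarrow> (T ^^ i) x = x"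
    using greedy_markers by metis
  interpret marked_system X T Y
    using assms(1,2) Y(1-3) by unfold_locales
  have "decisive diagram"
    by (rule decisive_diagram) (rule greedy_markers_interior[OF iso dense Y(2,4)])
  moreover obtain S where "homeomorphic_prolongation diagram S"
      "\<And>x. x \<in> topspace X \<Longrightarrow> code (T x) = S (code x)"
    using homeomorphic_prolongation_code by blast
  ultimately show ?thesis
    using homeomorphic_map_code
    unfolding bratteli_vershikizable_def topologically_conjugate_def by blast
qed

lemma topspace_path_space_nonempty:
  assumes "ordered_bratteli_diagram B"
  shows "topspace (path_space B) \<noteq> {}"
proof -
  have B: "vertex_level B 0 \<noteq> {}"
      "\<And>k e. e \<in> edge_level B k \<Longrightarrow> source B e \<in> vertex_level B (Suc k)"
      "\<And>k v. v \<in> vertex_level B k \<Longrightarrow> \<exists>e\<in>edge_level B k. target B e = v"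
    using assms unfolding ordered_bratteli_diagram_def bratteli_diagram_def by blast+
  have "\<exists>p. \<forall>k. p k \<in> edge_level B k \<and> target B (p (Suc k)) = source B (p k)"
    by (rule dependent_nat_choice) (use B in blast)+
  then show ?thesis
    by (auto simp: topspace_path_space)
qed

lemma topologically_conjugate_trans:
  assumes "topologically_conjugate X T Y S" "topologically_conjugate Y S Z R"
  shows "topologically_conjugate X T Z R"
proof -
  obtain h where h: "homeomorphic_map X Y h" "\<And>x. x \<in> topspace X \<Longrightarrow> h (T x) = S (h x)"
    using assms(1) unfolding topologically_conjugate_def by blast
  obtain g where g: "homeomorphic_map Y Z g" "\<And>y. y \<in> topspace Y \<Longrightarrow> g (S y) = R (g y)"
    using assms(2) unfolding topologically_conjugate_def by blast
  have "(g \<circ> h) (T x) = R ((g \<circ> h) x)" if "x \<in> topspace X" for x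
    using that h g homeomorphic_imp_surjective_map[OF h(1)] by auto
  then show ?thesis
    using homeomorphic_map_compose[OF h(1) g(1)] unfolding topologically_conjugate_def by blast
qed

lemma topologically_conjugate_cong:
  "(\<And>x. x \<in> topspace X \<Longrightarrow> T x = T' x) \<Longrightarrow> topologically_conjugate X T Y S \<longleftrightarrow> topologically_conjugate X T' Y S"
  unfolding topologically_conjugate_def by auto

theorem theorem6p4:
  fixes X :: "'a topology" and T :: "'a \<Rightarrow> 'a"
    and B :: "('v, 'e) ordered_bratteli"
  assumes "zero_dimensional_system X T"
    and "\<not> bratteli_vershikizable X T"
    and "BV_model B X T"
  shows "\<exists>S. homeomorphic_prolongation B S \<and>
             \<not> topologically_conjugate (path_space B) S X T"
proof (rule ccontr)
  assume "\<not> ?thesis"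
  then have all: "topologically_conjugate (path_space B) S X T" if "homeomorphic_prolongation B S" for S
    using that by blast
  let ?P = "path_space B"
  \<comment> \<open>Off the space \<open>T\<close> is arbitrary; the identity there gives a
    bijection of the type, as \<open>marked_system\<close> demands, and conjugacy does not see the
    change.\<close>
  define T' where "T' x = (if x \<in> topspace X then T x else x)" for x
  have T: "homeomorphic_map X X T" and X: "compact_space X" "metrizable_space X" "zero_dimensional_space X"
    using assms(1) unfolding zero_dimensional_system_def by auto
  have T': "homeomorphic_map X X T'"
    using homeomorphic_map_eq[OF T] by (simp add: T'_def)
  interpret zsystem X T'
    using X T' by unfold_locales
  have "bij T'"
  proof -
    have "bij_betw T' (topspace X) (topspace X)"
      using T' homeomorphic_imp_injective_map homeomorphic_imp_surjective_map
      unfolding bij_betw_def by blast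
    moreover have "bij_betw T' (- topspace X) (- topspace X)"
      by (subst bij_betw_cong[where g = id]) (auto simp: T'_def)
    ultimately have "bij_betw T' (topspace X \<union> - topspace X) (topspace X \<union> - topspace X)"
      by (intro bij_betw_combine) auto
    then show ?thesis
      by simp
  qed
  have B: "ordered_bratteli_diagram B"
    using assms(3) unfolding BV_model_def by blast
  obtain S where S: "vershik_prolongation B S" "topologically_conjugate ?P S X T"
    using assms(3) unfolding BV_model_def by blast
  obtain h where h: "homeomorphic_map ?P X h" "\<And>p. p \<in> topspace ?P \<Longrightarrow> h (S p) = T (h p)"
    using S(2) unfolding topologically_conjugate_def by blast
  obtain h' where h': "homeomorphic_maps ?P X h h'"
    using h(1) homeomorphic_map_maps by blast
  have hom_h': "homeomorphic_map X ?P h'"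
    using h' homeomorphic_maps_map by blast
  have hP: "h p \<in> topspace X" "h' (h p) = p" if "p \<in> topspace ?P" for p
    using h' that unfolding homeomorphic_maps_def continuous_map_def by auto
  have h'X: "h' x \<in> topspace ?P" "h (h' x) = x" if "x \<in> topspace X" for x
    using h' that unfolding homeomorphic_maps_def continuous_map_def by auto
  have SP: "S \<in> topspace ?P \<rightarrow> topspace ?P"
    using S(1) unfolding vershik_prolongation_def by blast
  have S_eq: "S p = h' (T' (h p))" if "p \<in> topspace ?P" for p
    using h(2)[OF that] hP SP that by (metis PiE T'_def)
  define M where "M = h ` {p. maximal_path B p}"
  have max_P: "maximal_path B p \<Longrightarrow> p \<in> topspace ?P" for p
    unfolding maximal_path_def by blast
  have M: "closedin X M"
    unfolding M_def using closedin_maximal_paths[OF B] homeomorphic_map_closedness[OF h(1)] max_P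
    by blast
  have hits: "\<exists>i. (T' ^^ i) x \<in> M" if x: "periodic x" for x
  proof -
    have xX: "x \<in> topspace X"
      using x unfolding periodic_def by blast
    obtain k where k: "k > 0" "(T' ^^ k) x = x"
      using x unfolding periodic_def by blast
    have h'T: "h' ((T' ^^ i) x) = (S ^^ i) (h' x)" for i
      using xX S_eq h'X by (intro conjugacy_funpow[where X = X]) auto
    then have "(S ^^ k) (h' x) = h' x"
      using k(2) by metis
    then obtain i where "maximal_path B ((S ^^ i) (h' x))"
      using periodic_hits_maximal[OF B S(1) h'X(1)[OF xX] k(1)] by blast
    then have "h (h' ((T' ^^ i) x)) \<in> M"
      unfolding M_def h'T by blast
    then show ?thesis
      using h'X(2) xX by (metis funpow_in)
  qed
  have conj: "topologically_conjugate X (T' \<circ> g) X T'"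
    if g: "homeomorphic_map X X g" "\<And>x. x \<in> topspace X \<Longrightarrow> x \<notin> M \<Longrightarrow> g x = x" for g
  proof -
    \<comment> \<open>The map on paths that corresponds to \<open>T' \<circ> g\<close>; it differs
      from \<open>S\<close> at most on maximal paths.\<close>
    define R where "R = h' \<circ> ((T' \<circ> g) \<circ> h)"
    have Tg: "homeomorphic_map X X (T' \<circ> g)"
      using homeomorphic_map_compose[OF g(1) T'] .
    have R: "homeomorphic_map ?P ?P R"
      unfolding R_def
      by (rule homeomorphic_map_compose[OF homeomorphic_map_compose[OF h(1) Tg] hom_h'])
    have "R p = S p" if p: "p \<in> topspace ?P" "\<not> maximal_path B p" for p
    proof -
      have "h p \<notin> M"
        using p hP max_P unfolding M_def by (metis imageE mem_Collect_eq)
      then show ?thesis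
        using g(2) hP(1)[OF p(1)] S_eq[OF p(1)] unfolding R_def by simp
    qed
    moreover have "R \<in> topspace ?P \<rightarrow> topspace ?P"
      using R homeomorphic_imp_surjective_map by blast
    ultimately have "homeomorphic_prolongation B R"
      using R S(1) unfolding homeomorphic_prolongation_def vershik_prolongation_def by simp
    then have RT: "topologically_conjugate ?P R X T"
      by (rule all)
    have "h' ((T' \<circ> g) x) = R (h' x)" if "x \<in> topspace X" for x
      using h'X[OF that] unfolding R_def by simp
    then have "topologically_conjugate X (T' \<circ> g) ?P R"
      using hom_h' unfolding topologically_conjugate_def by blast
    then have "topologically_conjugate X (T' \<circ> g) X T"
      using RT topologically_conjugate_trans by blast
    then obtain f where f: "homeomorphic_map X X f"
        "\<And>x. x \<in> topspace X \<Longrightarrow> f ((T' \<circ> g) x) = T (f x)"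
      unfolding topologically_conjugate_def by blast
    have "f ((T' \<circ> g) x) = T' (f x)" if "x \<in> topspace X" for x
      using f(2)[OF that] that homeomorphic_imp_surjective_map[OF f(1)] unfolding T'_def by auto
    then show ?thesis
      using f(1) unfolding topologically_conjugate_def by blast
  qed
  have "bratteli_vershikizable X T'"
  proof (rule vershikizable_if_few_periodic[OF \<open>bij T'\<close>])
    show "topspace X \<noteq> {}"
      using topspace_path_space_nonempty[OF B] hP(1) by blast
    show "y \<in> orbit x" if "openin X {x}" "periodic x" "openin X {y}" "periodic y" for x y
      using hits conj that by (rule isolated_periodic_same_orbit)
    show "\<exists>x\<in>V. openin X {x} \<or> \<not> periodic x" if "openin X V" "V \<noteq> {}" for V
      using M hits conj that by (rule no_perfect_periodic_open)
  qed
  moreover have cong: "topologically_conjugate X T' (path_space D) R \<longleftrightarrow> topologically_conjugate X T (path_space D) R"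
    for D :: "(nat, nat) ordered_bratteli" and R
    by (rule topologically_conjugate_cong) (simp add: T'_def)
  ultimately have "bratteli_vershikizable X T"
    unfolding bratteli_vershikizable_def
    by (simp add: cong)
  then show False
    using assms(2) by blast
qed

end
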